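(* Let $(\overline M,\overline\varphi,\overline\xi,\overline\eta,g)$ be an almost contact manifold with Norden metric, $\dim\overline M=2n+3$, and let $M$ be a submanifold of $\overline M$ of codimension $2$. Assume there are normal vector fields $N_1,N_2$ defined globally on $M$, spanning the normal space $\alpha=(T_pM)^\perp$ at each $p\in M$, such that: (i) $g(N_1,N_1)=-g(N_2,N_2)=1$ and $g(N_1,N_2)=0$; (ii) $g(N_i,\overline\varphi N_j)=0$ for all $i,j\in\{1,2\}$; (iii) at every $p\in M$, $\overline\xi\notin T_pM$ and $\overline\xi\notin\alpha$. Define vector fields $\xi_0,\xi_1,\xi_2$ on $M$, functions $a,b$ on $M$, $1$-forms $\eta^1,\eta^2$ on $M$ and a $(1,1)$-tensor field $\varphi$ on $M$ by the decompositions into tangential and normal parts $$\overline\xi=\xi_0+aN_1+bN_2,\qquad \overline\varphi X=\varphi X+\eta^1(X)N_1+\eta^2(X)N_2,\qquad \overline\varphi N_1=\xi_1,\qquad \overline\varphi N_2=-\xi_2,$$ for vector fields $X$ on $M$. Suppose that $a\ne 0$ and $|a|>|b|$ on $M$, and let $k$ be a function on $M$ with $a^2-b^2=k^2$. Let $\epsilon\in\{1,-1\}$ and put $$\lambda_1=\frac{\epsilon}{k(k+1)},\quad \mu_1=\frac{\epsilon(1+k^2+k)}{k(k+1)},\qquad \lambda_2=\frac{\epsilon}{k(k-1)},\quad \mu_2=\frac{\epsilon(1+k^2-k)}{k(k-1)}$$ whenever the denominators are nonzero. Suppose that one of the following holds: 1) $k\neq\pm1$ on $M$, and $(\lambda,\mu)=(\lambda_1,\mu_1)$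 or $(\lambda,\mu)=(\lambda_2,\mu_2)$; 2) $k=-1$ on $M$, and $(\lambda,\mu)=(\lambda_2,\mu_2)=(\tfrac{\epsilon}{2},\tfrac{3\epsilon}{2})$; 3) $k=1$ on $M$, and $(\lambda,\mu)=(\lambda_1,\mu_1)=(\tfrac{\epsilon}{2},\tfrac{3\epsilon}{2})$. Define on $M$ $$\xi=-\frac bk\,\xi_1+\frac ak\,\xi_2,\qquad \eta(X)=-\frac bk\,\eta^1(X)+\frac ak\,\eta^2(X),\qquad \phi X=\lambda\,\varphi^3X+\mu\,\varphi X .$$ Then $(\phi,\xi,\eta)$ is an almost contact structure on $M$ and the restriction of $g$ to $M$ is a Norden metric for it; that is, $(M,\phi,\xi,\eta,g)$ is a $(2n+1)$-dimensional almost contact manifold with Norden metric.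
   Context: All manifolds, tensor fields, functions are smooth. An almost contact manifold with Norden metric $(M,\varphi,\xi,\eta,g)$ of dimension $2m+1$ is a manifold with a $(1,1)$-tensor field $\varphi$, a vector field $\xi$, a $1$-form $\eta$ and a pseudo-Riemannian metric $g$ such that $(\varphi,\xi,\eta)$ is an almost contact structure, i.e. $\varphi^2=-\mathrm{id}+\eta\otimes\xi$ and $\eta(\xi)=1$, and $g$ is a Norden metric, i.e. $g(\varphi X,\varphi Y)=-g(X,Y)+\eta(X)\eta(Y)$ for all vector fields $X,Y$. Such a metric is indefinite of signature $(m+1,m)$. The restriction of $g$ to the submanifold is denoted by the same letter $g$. Normal spaces are taken with respect to $g$; under (ii), $\overline\varphi N_1$ and $\overline\varphi N_2$ are tangent to $M$, so $\xi_1,\xi_2$ are vector fields on $M$. *)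

theory Defs
  imports "HOL-Analysis.Analysis"
begin

section \<open>Smooth maps between Euclidean spaces\<close>

text \<open>Intended for open \<open>S\<close> only, where \<^term>\<open>frechet_derivative f (at x)\<close> is the derivative.\<close>

fun Ck_on :: "nat \<Rightarrow> ('e::euclidean_space \<Rightarrow> 'f::real_normed_vector) \<Rightarrow> 'e set \<Rightarrow> bool" where
  "Ck_on 0 f S \<longleftrightarrow> continuous_on S f"
| "Ck_on (Suc k) f S \<longleftrightarrow>
     f differentiable_on S \<and> (\<forall>v. Ck_on k (\<lambda>x. frechet_derivative f (at x) v) S)"

definition smooth_on :: "('e::euclidean_space \<Rightarrow> 'f::real_normed_vector) \<Rightarrow> 'e set \<Rightarrow> bool" where
  "smooth_on f S \<longleftrightarrow> (\<forall>k. Ck_on k f S)"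


section \<open>Smooth manifolds\<close>

text \<open>
  A chart \<open>(U, x)\<close> is a homeomorphism \<open>x\<close> from an open set \<open>U\<close> onto an open set of the model
  space \<open>'e\<close>; the values of \<open>x\<close> outside \<open>U\<close> are irrelevant. The dimension of a manifold is the
  dimension of its model space.
\<close>

type_synonym ('a, 'e) chart = "'a set \<times> ('a \<Rightarrow> 'e)"

record ('a, 'e) manifold =
  mtop :: "'a topology"
  atlas :: "('a, 'e) chart set"

abbreviation points :: "('a, 'e) manifold \<Rightarrow> 'a set" where
  "points M \<equiv> topspace (mtop M)"

definition mdim :: "('a, 'e::euclidean_space) manifold \<Rightarrow> nat" where
  "mdim M = DIM('e)"

definition chart_inv :: "('a, 'e) chart \<Rightarrow> 'e \<Rightarrow> 'a" where
  "chart_inv c = inv_into (fst c) (snd c)"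

definition is_chart :: "'a topology \<Rightarrow> ('a, 'e::euclidean_space) chart \<Rightarrow> bool" where
  "is_chart T c \<longleftrightarrow> openin T (fst c) \<and> open (snd c ` fst c) \<and>
     homeomorphic_map (subtopology T (fst c)) (top_of_set (snd c ` fst c)) (snd c)"

definition smooth_manifold :: "('a, 'e::euclidean_space) manifold \<Rightarrow> bool" where
  "smooth_manifold M \<longleftrightarrow>
     Hausdorff_space (mtop M) \<and> second_countable (mtop M) \<and>
     (\<forall>c\<in>atlas M. is_chart (mtop M) c) \<and>
     (\<Union>c\<in>atlas M. fst c) = points M \<and>
     (\<forall>c\<in>atlas M. \<forall>d\<in>atlas M. smooth_on (snd d \<circ> chart_inv c) (snd c ` (fst c \<inter> fst d)))"

definition smooth_function ::
    "('a, 'e::euclidean_space) manifold \<Rightarrow> ('a \<Rightarrow> 'v::real_normed_vector) \<Rightarrow> bool" where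
  "smooth_function M f \<longleftrightarrow> (\<forall>c\<in>atlas M. smooth_on (f \<circ> chart_inv c) (snd c ` fst c))"

definition smooth_map ::
    "('a, 'e::euclidean_space) manifold \<Rightarrow> ('b, 'f::euclidean_space) manifold \<Rightarrow> ('a \<Rightarrow> 'b) \<Rightarrow> bool" where
  "smooth_map M N F \<longleftrightarrow> continuous_map (mtop M) (mtop N) F \<and>
     (\<forall>c\<in>atlas M. \<forall>d\<in>atlas N.
        smooth_on (snd d \<circ> F \<circ> chart_inv c) (snd c ` (fst c \<inter> F -` fst d)))"


section \<open>Tangent vectors and tensor fields\<close>

text \<open>
  A tangent vector at \<open>p\<close> is represented by its components, an element of the model space \<open>'e\<close>,
  with respect to one chosen chart \<open>chart_at M p\<close> around \<open>p\<close>. This identifies every tangent space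
  with \<open>'e\<close> as a vector space. As the chosen chart may jump from point to point, smoothness of a
  field has to be tested on its components in the charts of the atlas: \<open>components M c p v\<close> are
  the components in the chart \<open>c\<close> of the tangent vector \<open>v\<close> at \<open>p\<close>, and conversely
  \<open>coord_vector M c p u\<close> is the tangent vector at \<open>p\<close> whose components in \<open>c\<close> are \<open>u\<close>.
\<close>

definition chart_at :: "('a, 'e) manifold \<Rightarrow> 'a \<Rightarrow> ('a, 'e) chart" where
  "chart_at M p = (SOME c. c \<in> atlas M \<and> p \<in> fst c)"

definition components ::
    "('a, 'e::euclidean_space) manifold \<Rightarrow> ('a, 'e) chart \<Rightarrow> 'a \<Rightarrow> 'e \<Rightarrow> 'e" where
  "components M c p =
     frechet_derivative (snd c \<circ> chart_inv (chart_at M p)) (at (snd (chart_at M p) p))"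

definition coord_vector ::
    "('a, 'e::euclidean_space) manifold \<Rightarrow> ('a, 'e) chart \<Rightarrow> 'a \<Rightarrow> 'e \<Rightarrow> 'e" where
  "coord_vector M c p =
     frechet_derivative (snd (chart_at M p) \<circ> chart_inv c) (at (snd c p))"

definition differential ::
    "('a, 'e::euclidean_space) manifold \<Rightarrow> ('b, 'f::euclidean_space) manifold \<Rightarrow>
     ('a \<Rightarrow> 'b) \<Rightarrow> 'a \<Rightarrow> 'e \<Rightarrow> 'f" where
  "differential M N F p =
     frechet_derivative (snd (chart_at N (F p)) \<circ> F \<circ> chart_inv (chart_at M p))
       (at (snd (chart_at M p) p))"

text \<open>Smooth sections \<open>X\<close> of the pullback bundle \<open>F\<^sup>* TN\<close>, that is, \<open>X p\<close> is tangent to \<open>N\<close> at \<open>F p\<close>.\<close>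

definition vector_field_along ::
    "('a, 'e::euclidean_space) manifold \<Rightarrow> ('b, 'f::euclidean_space) manifold \<Rightarrow>
     ('a \<Rightarrow> 'b) \<Rightarrow> ('a \<Rightarrow> 'f) \<Rightarrow> bool" where
  "vector_field_along M N F X \<longleftrightarrow>
     (\<forall>c\<in>atlas M. \<forall>d\<in>atlas N.
        smooth_on ((\<lambda>p. components N d (F p) (X p)) \<circ> chart_inv c)
          (snd c ` (fst c \<inter> F -` fst d)))"

definition vector_field :: "('a, 'e::euclidean_space) manifold \<Rightarrow> ('a \<Rightarrow> 'e) \<Rightarrow> bool" where
  "vector_field M X \<longleftrightarrow>
     (\<forall>c\<in>atlas M. smooth_on ((\<lambda>p. components M c p (X p)) \<circ> chart_inv c) (snd c ` fst c))"

definition one_form :: "('a, 'e::euclidean_space) manifold \<Rightarrow> ('a \<Rightarrow> 'e \<Rightarrow> real) \<Rightarrow> bool" where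
  "one_form M \<omega> \<longleftrightarrow> (\<forall>p\<in>points M. linear (\<omega> p)) \<and>
     (\<forall>c\<in>atlas M. \<forall>u.
        smooth_on ((\<lambda>p. \<omega> p (coord_vector M c p u)) \<circ> chart_inv c) (snd c ` fst c))"

definition tensor_field_11 :: "('a, 'e::euclidean_space) manifold \<Rightarrow> ('a \<Rightarrow> 'e \<Rightarrow> 'e) \<Rightarrow> bool" where
  "tensor_field_11 M A \<longleftrightarrow> (\<forall>p\<in>points M. linear (A p)) \<and>
     (\<forall>c\<in>atlas M. \<forall>u.
        smooth_on ((\<lambda>p. components M c p (A p (coord_vector M c p u))) \<circ> chart_inv c)
          (snd c ` fst c))"

definition tensor_field_02 ::
    "('a, 'e::euclidean_space) manifold \<Rightarrow> ('a \<Rightarrow> 'e \<Rightarrow> 'e \<Rightarrow> real) \<Rightarrow> bool" where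
  "tensor_field_02 M g \<longleftrightarrow> (\<forall>p\<in>points M. bilinear (g p)) \<and>
     (\<forall>c\<in>atlas M. \<forall>u v.
        smooth_on ((\<lambda>p. g p (coord_vector M c p u) (coord_vector M c p v)) \<circ> chart_inv c)
          (snd c ` fst c))"


section \<open>Pseudo-Riemannian metrics and submanifolds\<close>

definition has_signature :: "('e::euclidean_space \<Rightarrow> 'e \<Rightarrow> real) \<Rightarrow> nat \<Rightarrow> nat \<Rightarrow> bool" where
  "has_signature B r s \<longleftrightarrow> r + s = DIM('e) \<and>
     (\<exists>P Q. subspace P \<and> dim P = r \<and> (\<forall>v\<in>P. v \<noteq> 0 \<longrightarrow> B v v > 0) \<and>
            subspace Q \<and> dim Q = s \<and> (\<forall>v\<in>Q. v \<noteq> 0 \<longrightarrow> B v v < 0))"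

definition pseudo_riemannian_metric ::
    "('a, 'e::euclidean_space) manifold \<Rightarrow> ('a \<Rightarrow> 'e \<Rightarrow> 'e \<Rightarrow> real) \<Rightarrow> bool" where
  "pseudo_riemannian_metric M g \<longleftrightarrow> tensor_field_02 M g \<and>
     (\<forall>p\<in>points M. \<forall>u v. g p u v = g p v u) \<and>
     (\<forall>p\<in>points M. \<forall>u. (\<forall>v. g p u v = 0) \<longrightarrow> u = 0) \<and>
     (\<exists>r s. \<forall>p\<in>points M. has_signature (g p) r s)"

text \<open>
  A submanifold is a subset with a topology and a smooth structure of its own for which the
  inclusion is an immersion; the topology may be finer than the subspace topology. Its tangent
  space at \<open>p\<close> is seen in that of the ambient manifold through the differential of the inclusion.
\<close>

definition incl ::
    "('a, 'f::euclidean_space) manifold \<Rightarrow> ('a, 'e::euclidean_space) manifold \<Rightarrow> 'a \<Rightarrow> 'f \<Rightarrow> 'e" where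
  "incl M N = differential M N (\<lambda>p. p)"

definition submanifold ::
    "('a, 'f::euclidean_space) manifold \<Rightarrow> ('a, 'e::euclidean_space) manifold \<Rightarrow> bool" where
  "submanifold M N \<longleftrightarrow> smooth_manifold M \<and> points M \<subseteq> points N \<and>
     smooth_map M N (\<lambda>p. p) \<and> (\<forall>p\<in>points M. inj (incl M N p))"

definition tangent_space ::
    "('a, 'f::euclidean_space) manifold \<Rightarrow> ('a, 'e::euclidean_space) manifold \<Rightarrow> 'a \<Rightarrow> 'e set" where
  "tangent_space M N p = range (incl M N p)"

definition normal_space_at ::
    "('a, 'f::euclidean_space) manifold \<Rightarrow> ('a, 'e::euclidean_space) manifold \<Rightarrow>
     ('a \<Rightarrow> 'e \<Rightarrow> 'e \<Rightarrow> real) \<Rightarrow> 'a \<Rightarrow> 'e set" where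
  "normal_space_at M N g p = {v. \<forall>w\<in>tangent_space M N p. g p v w = 0}"

definition restrict_metric ::
    "('a, 'f::euclidean_space) manifold \<Rightarrow> ('a, 'e::euclidean_space) manifold \<Rightarrow>
     ('a \<Rightarrow> 'e \<Rightarrow> 'e \<Rightarrow> real) \<Rightarrow> 'a \<Rightarrow> 'f \<Rightarrow> 'f \<Rightarrow> real" where
  "restrict_metric M N g p u v = g p (incl M N p u) (incl M N p v)"


section \<open>Almost contact manifolds with Norden metric\<close>

definition almost_contact_structure ::
    "('a, 'e::euclidean_space) manifold \<Rightarrow> ('a \<Rightarrow> 'e \<Rightarrow> 'e) \<Rightarrow> ('a \<Rightarrow> 'e) \<Rightarrow> ('a \<Rightarrow> 'e \<Rightarrow> real) \<Rightarrow> bool" where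
  "almost_contact_structure M \<phi> \<xi> \<eta> \<longleftrightarrow>
     tensor_field_11 M \<phi> \<and> vector_field M \<xi> \<and> one_form M \<eta> \<and>
     (\<forall>p\<in>points M. (\<forall>X. \<phi> p (\<phi> p X) = - X + \<eta> p X *\<^sub>R \<xi> p) \<and> \<eta> p (\<xi> p) = 1)"

definition norden_metric ::
    "('a, 'e::euclidean_space) manifold \<Rightarrow> ('a \<Rightarrow> 'e \<Rightarrow> 'e) \<Rightarrow> ('a \<Rightarrow> 'e \<Rightarrow> real) \<Rightarrow>
     ('a \<Rightarrow> 'e \<Rightarrow> 'e \<Rightarrow> real) \<Rightarrow> bool" where
  "norden_metric M \<phi> \<eta> g \<longleftrightarrow> pseudo_riemannian_metric M g \<and>
     (\<forall>p\<in>points M. \<forall>X Y. g p (\<phi> p X) (\<phi> p Y) = - g p X Y + \<eta> p X * \<eta> p Y)"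

definition almost_contact_norden_manifold ::
    "('a, 'e::euclidean_space) manifold \<Rightarrow> ('a \<Rightarrow> 'e \<Rightarrow> 'e) \<Rightarrow> ('a \<Rightarrow> 'e) \<Rightarrow> ('a \<Rightarrow> 'e \<Rightarrow> real) \<Rightarrow>
     ('a \<Rightarrow> 'e \<Rightarrow> 'e \<Rightarrow> real) \<Rightarrow> bool" where
  "almost_contact_norden_manifold M \<phi> \<xi> \<eta> g \<longleftrightarrow>
     smooth_manifold M \<and> (\<exists>m. mdim M = 2 * m + 1) \<and>
     almost_contact_structure M \<phi> \<xi> \<eta> \<and> norden_metric M \<phi> \<eta> g"


section \<open>The coefficient functions\<close>

definition lambda1 :: "real \<Rightarrow> real \<Rightarrow> real" where "lambda1 \<epsilon> k = \<epsilon> / (k * (k + 1))"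
definition mu1 :: "real \<Rightarrow> real \<Rightarrow> real" where "mu1 \<epsilon> k = \<epsilon> * (1 + k\<^sup>2 + k) / (k * (k + 1))"
definition lambda2 :: "real \<Rightarrow> real \<Rightarrow> real" where "lambda2 \<epsilon> k = \<epsilon> / (k * (k - 1))"
definition mu2 :: "real \<Rightarrow> real \<Rightarrow> real" where "mu2 \<epsilon> k = \<epsilon> * (1 + k\<^sup>2 - k) / (k * (k - 1))"

end

theory Submission
  imports Defs
begin

text \<open>
  At a point, put \<open>\<zeta> = \<phi> \<xi>\<^sub>0\<close> and let \<open>T X = g(X, \<xi>\<^sub>0) \<xi>\<^sub>0 - g(X, \<zeta>) \<zeta> / k\<^sup>2\<close>. Comparing
  tangential and normal parts of \<open>\<phi>\<^sup>2 = - id + \<eta> \<otimes> \<xi>\<close> in the ambient space gives, on the submanifold,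
  \<open>\<phi>\<^sup>2 = - id + \<eta> \<otimes> \<xi> + T\<close> with \<open>\<phi> \<xi> = 0\<close>, \<open>\<eta> T = 0\<close>, \<open>T \<phi> = \<phi> T\<close> and \<open>T\<^sup>2 = (1 - k\<^sup>2) T\<close>. Hence
  \<open>\<lambda> \<phi>\<^sup>3 + \<mu> \<phi> = \<phi> ((\<mu> - \<lambda>) id + \<lambda> T)\<close>, whose square is \<open>- id + \<eta> \<otimes> \<xi>\<close> as soon as
  \<open>(\<mu> - \<lambda>)\<^sup>2 = 1\<close> and \<open>k\<^sup>2 \<lambda> (2 \<mu> - \<lambda> - \<lambda> k\<^sup>2) = 1\<close>; both hold for the given coefficients. The Norden
  identity follows because \<open>\<phi>\<close> is self-adjoint for \<open>g\<close>.

  The tangential parts are smooth because a solution \<open>v\<close> of \<open>A(x) v(x) = w(x)\<close> with \<open>A(x)\<close> linear and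
  injective is as smooth as \<open>A\<close> and \<open>w\<close>. The restricted metric has constant signature because the
  normal space has signature \<open>(1, 1)\<close>.
\<close>

section \<open>Calculus of smooth maps\<close>

lemma frechet_derivative_eqI: "(f has_derivative f') (at x) \<Longrightarrow> frechet_derivative f (at x) = f'"
  by (rule frechet_derivative_at[symmetric])

text \<open>The Frechet derivative at a point of \<open>S\<close> depends on a whole neighbourhood;
  openness of \<open>S\<close> keeps that neighbourhood where \<open>f\<close> and \<open>g\<close>
  agree, so the derivatives agree on \<open>S\<close> too and the induction can continue.\<close>

lemma Ck_on_cong:
  assumes "open S" "\<And>x. x \<in> S \<Longrightarrow> f x = g x"
  shows "Ck_on k f S \<longleftrightarrow> Ck_on k g S"
  using assms(2)
proof (induction k arbitrary: f g)
  case 0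
  then show ?case by (simp cong: continuous_on_cong)
next
  case (Suc k)
  have d: "f differentiable_on S \<longleftrightarrow> g differentiable_on S"
    using Suc.prems unfolding differentiable_on_eq_differentiable_at[OF assms(1)]
    unfolding differentiable_def
    by (metis assms(1) has_derivative_transform_within_open)
  show ?case
  proof (cases "f differentiable_on S")
    case True
    have "frechet_derivative f (at x) = frechet_derivative g (at x)" if "x \<in> S" for x
      using frechet_derivative_transform_within_open[OF _ assms(1) that] True Suc.prems that
      unfolding differentiable_on_eq_differentiable_at[OF assms(1)] by blast
    then have "Ck_on k (\<lambda>x. frechet_derivative f (at x) v) S
        \<longleftrightarrow> Ck_on k (\<lambda>x. frechet_derivative g (at x) v) S" for v
      by (intro Suc.IH) metis
    then show ?thesis
      using d by simp
  qed (use d in simp)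
qed

lemma Ck_on_subset: "Ck_on k f S \<Longrightarrow> T \<subseteq> S \<Longrightarrow> Ck_on k f T"
proof (induction k arbitrary: f)
  case 0
  then show ?case by (metis Ck_on.simps(1) continuous_on_subset)
next
  case (Suc k)
  then show ?case by (metis Ck_on.simps(2) differentiable_on_subset)
qed

lemma Ck_on_Suc_D: "Ck_on (Suc k) f S \<Longrightarrow> Ck_on k f S"
proof (induction k arbitrary: f)
  case 0
  then show ?case by (metis Ck_on.simps differentiable_imp_continuous_on)
next
  case (Suc k)
  then show ?case by (metis Ck_on.simps(2))
qed

lemma Ck_on_local:
  assumes "\<And>x. x \<in> S \<Longrightarrow> \<exists>T. open T \<and> x \<in> T \<and> Ck_on k f T"
  shows "Ck_on k f S"
  using assms
proof (induction k arbitrary: f)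
  case 0
  then have "\<forall>x\<in>S. isCont f x"
    by (metis Ck_on.simps(1) continuous_on_eq_continuous_at)
  then show ?case
    by (simp add: continuous_at_imp_continuous_on)
next
  case (Suc k)
  have "f differentiable_on S"
    unfolding differentiable_on_def
    by (metis Ck_on.simps(2) Suc.prems differentiable_at_withinI
        differentiable_on_eq_differentiable_at)
  moreover have "Ck_on k (\<lambda>x. frechet_derivative f (at x) v) S" for v
    by (rule Suc.IH) (metis Ck_on.simps(2) Suc.prems)
  ultimately show ?case by simp
qed

lemma Ck_on_has_derivative:
  assumes "Ck_on (Suc k) f S" "open S" "x \<in> S"
  shows "(f has_derivative frechet_derivative f (at x)) (at x)"
  using assms by (simp add: differentiable_on_eq_differentiable_at frechet_derivative_works)

text \<open>Uniqueness of derivatives lets any derivative obtained from calculus rules replace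
  \<open>frechet_derivative\<close>. The closure lemmas proved by induction on the order rest on
  this.\<close>

lemma Ck_on_SucI:
  assumes "open S" "\<And>x. x \<in> S \<Longrightarrow> (f has_derivative f' x) (at x)" "\<And>v. Ck_on k (\<lambda>x. f' x v) S"
  shows "Ck_on (Suc k) f S"
proof -
  have "f differentiable_on S"
    using assms by (metis differentiable_def differentiable_on_eq_differentiable_at)
  moreover have "Ck_on k (\<lambda>x. frechet_derivative f (at x) v) S" for v
    using Ck_on_cong[OF assms(1), of "\<lambda>x. frechet_derivative f (at x) v" "\<lambda>x. f' x v"]
      frechet_derivative_eqI[OF assms(2)] assms(3) by simp
  ultimately show ?thesis by simp
qed

lemma Ck_on_const: "open S \<Longrightarrow> Ck_on k (\<lambda>x. c) S"
proof (induction k arbitrary: c)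
  case (Suc k)
  show ?case
    by (rule Ck_on_SucI[OF Suc.prems has_derivative_const]) (rule Suc.IH[OF Suc.prems])
qed simp

lemma Ck_on_bounded_linear:
  assumes "bounded_linear h" "open S" "Ck_on k f S"
  shows "Ck_on k (\<lambda>x. h (f x)) S"
  using assms(3)
proof (induction k arbitrary: f)
  case 0
  then show ?case using assms(1) by (simp add: bounded_linear.continuous_on)
next
  case (Suc k)
  show ?case
  proof (rule Ck_on_SucI[OF assms(2)])
    show "((\<lambda>x. h (f x)) has_derivative (\<lambda>v. h (frechet_derivative f (at x) v))) (at x)"
      if "x \<in> S" for x
      by (rule bounded_linear.has_derivative[OF assms(1) Ck_on_has_derivative[OF Suc.prems assms(2) that]])
    show "Ck_on k (\<lambda>x. h (frechet_derivative f (at x) v)) S" for v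
      using Suc.IH Suc.prems by simp
  qed
qed

lemma Ck_on_add:
  assumes "open S" "Ck_on k f S" "Ck_on k g S"
  shows "Ck_on k (\<lambda>x. f x + g x) S"
  using assms(2,3)
proof (induction k arbitrary: f g)
  case 0
  then show ?case by (simp add: continuous_on_add)
next
  case (Suc k)
  show ?case
    by (rule Ck_on_SucI[OF assms(1) has_derivative_add[OF Ck_on_has_derivative Ck_on_has_derivative]])
      (use Suc assms(1) in auto)
qed

lemma (in bounded_bilinear) Ck_on_prod:
  assumes "open S" "Ck_on k f S" "Ck_on k g S"
  shows "Ck_on k (\<lambda>x. prod (f x) (g x)) S"
  using assms(2,3)
proof (induction k arbitrary: f g)
  case 0
  then show ?case by (simp add: continuous_on)
next
  case (Suc k)
  show ?case
  proof (rule Ck_on_SucI[OF assms(1) FDERIV[OF Ck_on_has_derivative Ck_on_has_derivative]])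
    \<comment> \<open>Each Leibniz term contains one undifferentiated factor, whose order is first
      lowered to that of the derivative beside it.\<close>
    have "Ck_on k f S" "Ck_on k g S"
      using Suc.prems by (blast intro: Ck_on_Suc_D)+
    then show "Ck_on k (\<lambda>x. prod (f x) (frechet_derivative g (at x) v)
        + prod (frechet_derivative f (at x) v) (g x)) S" for v
      using Suc.prems by (intro Ck_on_add assms(1) Suc.IH) simp_all
  qed (use Suc.prems assms(1) in auto)
qed

lemma Ck_on_sum:
  assumes "open S" "finite I" "\<And>i. i \<in> I \<Longrightarrow> Ck_on k (f i) S"
  shows "Ck_on k (\<lambda>x. \<Sum>i\<in>I. f i x) S"
  using assms(2,3) by (induction I) (auto intro: Ck_on_add Ck_on_const assms(1))

lemma linear_basis_expansion:
  fixes L :: "'f::euclidean_space \<Rightarrow> 'g::real_vector"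
  assumes "linear L"
  shows "L u = (\<Sum>b\<in>Basis. (u \<bullet> b) *\<^sub>R L b)"
proof -
  have "L u = L (\<Sum>b\<in>Basis. (u \<bullet> b) *\<^sub>R b)"
    by (simp add: euclidean_representation)
  also have "\<dots> = (\<Sum>b\<in>Basis. (u \<bullet> b) *\<^sub>R L b)"
    by (simp add: linear_sum[OF assms] linear_scale[OF assms])
  finally show ?thesis .
qed

text \<open>Expanding \<open>u x\<close> in the standard basis leaves a finite sum of products.
  Regularity of \<open>L\<close> is asked only on constant vectors, the form in which the
  definitions of tensor fields provide it.\<close>

lemma Ck_on_linear_apply:
  fixes L :: "'e::euclidean_space \<Rightarrow> 'f::euclidean_space \<Rightarrow> 'g::real_normed_vector"
  assumes "open S" "\<And>x. x \<in> S \<Longrightarrow> linear (L x)" "\<And>b. Ck_on k (\<lambda>x. L x b) S" "Ck_on k u S"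
  shows "Ck_on k (\<lambda>x. L x (u x)) S"
proof -
  have "Ck_on k (\<lambda>x. \<Sum>b\<in>Basis. (u x \<bullet> b) *\<^sub>R L x b) S"
    by (intro Ck_on_sum bounded_bilinear.Ck_on_prod[OF bounded_bilinear_scaleR]
        Ck_on_bounded_linear[OF bounded_linear_inner_left] assms finite_Basis)
  then show ?thesis
    by (rule Ck_on_cong[OF assms(1), THEN iffD1, rotated])
      (rule linear_basis_expansion[OF assms(2), symmetric])
qed

text \<open>By the chain rule the derivative is a linear map depending on \<open>x\<close> applied
  to a vector depending on \<open>x\<close>, so the induction over varying \<open>f\<close> reduces
  to \<open>Ck_on_linear_apply\<close>.\<close>

lemma Ck_on_compose:
  fixes g :: "'e::euclidean_space \<Rightarrow> 'f::euclidean_space" and f :: "'f \<Rightarrow> 'g::real_normed_vector"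
  assumes "open S" "open T" "g ` S \<subseteq> T" "Ck_on k g S" "Ck_on k f T"
  shows "Ck_on k (f \<circ> g) S"
  using assms(4,5)
proof (induction k arbitrary: f)
  case 0
  then show ?case
    using assms(3) by (metis Ck_on.simps(1) continuous_on_compose continuous_on_subset)
next
  case (Suc k)
  have d: "(f has_derivative frechet_derivative f (at (g x))) (at (g x))" if "x \<in> S" for x
    using Ck_on_has_derivative[OF Suc.prems(2) assms(2)] that assms(3) by blast
  show ?case
  proof (rule Ck_on_SucI[OF assms(1)])
    show "(f \<circ> g has_derivative frechet_derivative f (at (g x)) \<circ> frechet_derivative g (at x)) (at x)"
      if "x \<in> S" for x
      by (rule diff_chain_at[OF Ck_on_has_derivative[OF Suc.prems(1) assms(1) that] d[OF that]])
    have "Ck_on k (\<lambda>x. frechet_derivative f (at (g x)) (frechet_derivative g (at x) v)) S" for v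
    proof (rule Ck_on_linear_apply[OF assms(1)])
      show "linear (frechet_derivative f (at (g x)))" if "x \<in> S" for x
        using d[OF that] has_derivative_linear by blast
      show "Ck_on k (\<lambda>x. frechet_derivative f (at (g x)) b) S" for b
        using Suc.IH[of "\<lambda>y. frechet_derivative f (at y) b"] Suc.prems Ck_on_Suc_D[OF Suc.prems(1)]
        by (simp add: o_def)
      show "Ck_on k (\<lambda>x. frechet_derivative g (at x) v) S"
        using Suc.prems by simp
    qed
    then show "Ck_on k (\<lambda>x. (frechet_derivative f (at (g x)) \<circ> frechet_derivative g (at x)) v) S" for v
      by simp
  qed
qed

text \<open>Where \<open>g\<close> vanishes, the product rule has no term with a derivative of
  \<open>f\<close>, so continuity of \<open>f\<close> suffices. This is applied to a solution of a
  linear system that is so far only known to be continuous.\<close>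

lemma continuous_scaleR_vanishing_has_derivative:
  fixes f :: "'e::real_normed_vector \<Rightarrow> real" and g :: "'e \<Rightarrow> 'g::real_normed_vector"
  assumes f: "isCont f a" and g: "(g has_derivative g') (at a)" "g a = 0"
  shows "((\<lambda>x. f x *\<^sub>R g x) has_derivative (\<lambda>v. f a *\<^sub>R g' v)) (at a)"
proof -
  have bl: "bounded_linear g'" using g(1) by (rule has_derivative_bounded_linear)
  then obtain K where K: "K > 0" "\<And>v. norm (g' v) \<le> norm v * K"
    using bounded_linear.pos_bounded by blast
  have lim: "((\<lambda>x. norm (g x - g a - g' (x - a)) / norm (x - a)) \<longlongrightarrow> 0) (at a)"
    using g(1) by (simp add: has_derivative_iff_norm)
  have "((\<lambda>x. \<bar>f x\<bar> * (norm (g x - g a - g' (x - a)) / norm (x - a)) + \<bar>f x - f a\<bar> * K) \<longlongrightarrow>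
          \<bar>f a\<bar> * 0 + \<bar>f a - f a\<bar> * K) (at a)"
    by (intro tendsto_intros lim) (use f in \<open>auto simp: isCont_def\<close>)
  then have "((\<lambda>x. \<bar>f x\<bar> * (norm (g x - g a - g' (x - a)) / norm (x - a)) + \<bar>f x - f a\<bar> * K) \<longlongrightarrow> 0) (at a)"
    by simp
  moreover have "norm (f x *\<^sub>R g x - f a *\<^sub>R g a - f a *\<^sub>R g' (x - a)) / norm (x - a)
      \<le> \<bar>f x\<bar> * (norm (g x - g a - g' (x - a)) / norm (x - a)) + \<bar>f x - f a\<bar> * K" if "x \<noteq> a" for x
  proof -
    \<comment> \<open>The remainder splits into a multiple of the remainder of \<open>g\<close> and
      a term of relative size at most \<open>\<bar>f x - f a\<bar> * K\<close>.\<close>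
    have "f x *\<^sub>R g x - f a *\<^sub>R g a - f a *\<^sub>R g' (x - a) =
        f x *\<^sub>R (g x - g a - g' (x - a)) + (f x - f a) *\<^sub>R g' (x - a)"
      using g(2) by (simp add: algebra_simps)
    then have "norm (f x *\<^sub>R g x - f a *\<^sub>R g a - f a *\<^sub>R g' (x - a)) \<le>
        \<bar>f x\<bar> * norm (g x - g a - g' (x - a)) + \<bar>f x - f a\<bar> * norm (g' (x - a))"
      by (metis norm_scaleR norm_triangle_ineq)
    also have "\<dots> \<le> \<bar>f x\<bar> * norm (g x - g a - g' (x - a)) + \<bar>f x - f a\<bar> * (norm (x - a) * K)"
      by (intro add_left_mono mult_left_mono K) simp
    finally show ?thesis using that by (simp add: field_simps)
  qed
  ultimately have "((\<lambda>x. norm (f x *\<^sub>R g x - f a *\<^sub>R g a - f a *\<^sub>R g' (x - a)) / norm (x - a)) \<longlongrightarrow> 0) (at a)"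
    by (elim Lim_null_comparison[rotated]) (auto simp: eventually_at_filter)
  then show ?thesis
    by (simp add: has_derivative_iff_norm bounded_linear_const_scaleR bl)
qed

text \<open>A left inverse \<open>B\<close> of \<open>A a\<close> recovers \<open>v x - v a\<close>
  from \<open>A a (v x)\<close>, which differs from \<open>w x\<close> by
  \<open>A x (v x) - A a (v x)\<close>. The system may have more equations than unknowns, as for the
  differential of an immersion.\<close>

lemma isCont_linear_solution:
  fixes A :: "'e::euclidean_space \<Rightarrow> 'f::euclidean_space \<Rightarrow> 'g::euclidean_space"
  assumes S: "open S" "a \<in> S" and lin: "\<And>x. x \<in> S \<Longrightarrow> linear (A x)" and inj: "inj (A a)"
    and cA: "\<And>b. isCont (\<lambda>x. A x b) a" and cw: "isCont w a"
    and eq: "\<And>x. x \<in> S \<Longrightarrow> A x (v x) = w x"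
  shows "isCont v a"
proof -
  obtain B where B: "linear B" "B \<circ> A a = id"
    using linear_injective_left_inverse[OF lin[OF S(2)] inj] by blast
  then obtain C where C: "C > 0" "\<And>y. norm (B y) \<le> C * norm y"
    using linear_bounded_pos by blast
  define K where "K x = (\<Sum>b\<in>Basis. norm (A x b - A a b))" for x
  define e where "e x = norm (w x - w a)" for x
  have Kb: "norm (A x u - A a u) \<le> K x * norm u" if "x \<in> S" for x u
  proof -
    have "linear (\<lambda>u. A x u - A a u)"
      by (intro linear_compose_sub lin that S(2))
    then have "A x u - A a u = (\<Sum>b\<in>Basis. (u \<bullet> b) *\<^sub>R (A x b - A a b))"
      by (rule linear_basis_expansion)
    also have "norm \<dots> \<le> (\<Sum>b\<in>Basis. norm u * norm (A x b - A a b))"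
      by (intro sum_norm_le) (simp add: Basis_le_norm mult_right_mono)
    finally show ?thesis by (simp add: K_def sum_distrib_left mult.commute)
  qed
  have K0: "K x \<ge> 0" for x by (simp add: K_def sum_nonneg)
  have diff: "norm (v x - v a) \<le> C * (K x * norm (v x) + e x)" if "x \<in> S" for x
  proof -
    have "v x - v a = B (A a (v x) - A a (v a))"
      using B linear_diff[OF lin[OF S(2)]] by (metis comp_apply id_apply)
    also have "A a (v x) - A a (v a) = (w x - w a) - (A x (v x) - A a (v x))"
      using eq[OF that] eq[OF S(2)] by simp
    finally have "norm (v x - v a) \<le> C * norm ((w x - w a) - (A x (v x) - A a (v x)))"
      using C(2) by metis
    also have "\<dots> \<le> C * (K x * norm (v x) + e x)"
      using C(1) Kb[OF that, of "v x"] norm_triangle_ineq4[of "w x - w a" "A x (v x) - A a (v x)"]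
      by (intro mult_left_mono) (auto simp: e_def)
    finally show ?thesis .
  qed
  have "(K \<longlongrightarrow> (\<Sum>b\<in>Basis. norm (A a b - A a b))) (at a)"
    unfolding K_def using cA by (intro tendsto_intros) (auto simp: isCont_def)
  then have Kl: "(K \<longlongrightarrow> 0) (at a)" by simp
  have "(e \<longlongrightarrow> norm (w a - w a)) (at a)"
    unfolding e_def using cw by (intro tendsto_intros) (auto simp: isCont_def)
  then have el: "(e \<longlongrightarrow> 0) (at a)" by simp
  \<comment> \<open>No bound on \<open>v\<close> near \<open>a\<close> is known yet. Below this
    threshold the term \<open>C * K x * norm (v x)\<close> is at most half of
    \<open>norm (v x)\<close> and can be absorbed, which bounds \<open>v\<close>.\<close>
  have small: "\<forall>\<^sub>F x in at a. K x < 1 / (2 * C)"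
    using order_tendstoD(2)[OF Kl] C(1) by simp
  have inS: "\<forall>\<^sub>F x in at a. x \<in> S"
    using S by (simp add: eventually_at_in_open')
  have "\<forall>\<^sub>F x in at a. norm (v x - v a) \<le> C * (K x * (2 * norm (v a) + 2 * C * e x) + e x)"
    using small inS
  proof eventually_elim
    case (elim x)
    have "C * K x \<le> 1 / 2" using elim(1) C(1) by (simp add: field_simps)
    then have "C * K x * norm (v x) \<le> 1 / 2 * norm (v x)"
      by (rule mult_right_mono) simp
    then have "norm (v x) \<le> 2 * norm (v a) + 2 * C * e x"
      using diff[OF elim(2)] norm_triangle_ineq2[of "v x" "v a"] by (simp add: algebra_simps)
    then have "C * (K x * norm (v x) + e x) \<le> C * (K x * (2 * norm (v a) + 2 * C * e x) + e x)"
      using C(1) K0 by (intro mult_left_mono add_right_mono) auto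
    then show ?case using diff[OF elim(2)] by linarith
  qed
  moreover have "((\<lambda>x. C * (K x * (2 * norm (v a) + 2 * C * e x) + e x)) \<longlongrightarrow>
      C * (0 * (2 * norm (v a) + 2 * C * 0) + 0)) (at a)"
    by (intro tendsto_intros Kl el)
  ultimately have "((\<lambda>x. v x - v a) \<longlongrightarrow> 0) (at a)"
    using Lim_null_comparison by fastforce
  then show ?thesis
    by (simp add: isCont_def LIM_zero_iff)
qed

text \<open>The second claim is the differentiated equation \<open>A x (v x) = w x\<close>. The work
  lies in the first: the product rule may be used only once \<open>v\<close> is known to be
  differentiable.\<close>

lemma has_derivative_linear_solution:
  fixes A :: "'e::euclidean_space \<Rightarrow> 'f::euclidean_space \<Rightarrow> 'g::euclidean_space"
  assumes S: "open S" "a \<in> S" and lin: "\<And>x. x \<in> S \<Longrightarrow> linear (A x)" and inj: "inj (A a)"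
    and dA: "\<And>b. ((\<lambda>x. A x b) has_derivative A' b) (at a)" and dw: "(w has_derivative w') (at a)"
    and eq: "\<And>x. x \<in> S \<Longrightarrow> A x (v x) = w x"
  shows "v differentiable (at a)"
    and "A a (frechet_derivative v (at a) d) = w' d - A' (v a) d"
proof -
  have cont: "isCont v a"
  proof (rule isCont_linear_solution[where A = A and w = w, OF S lin inj _ _ eq])
    show "isCont (\<lambda>x. A x b) a" for b
      using dA has_derivative_continuous by blast
    show "isCont w a"
      using dw has_derivative_continuous by blast
  qed
  obtain B where B: "linear B" "B \<circ> A a = id"
    using linear_injective_left_inverse[OF lin[OF S(2)] inj] by blast
  \<comment> \<open>On \<open>S\<close>, \<open>D x\<close> equals \<open>A a (v x - v a)\<close>.
    In this form \<open>v x\<close> occurs only as a coefficient of \<open>A x b - A a b\<close>,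
    which vanishes at \<open>a\<close>, so continuity of \<open>v\<close> makes \<open>D\<close>
    differentiable.\<close>
  define D where "D x = (w x - w a) - (\<Sum>b\<in>Basis. (v x \<bullet> b) *\<^sub>R (A x b - A a b))" for x
  have dD: "(D has_derivative (\<lambda>d. (w' d - 0) - (\<Sum>b\<in>Basis. (v a \<bullet> b) *\<^sub>R (A' b d - 0)))) (at a)"
    unfolding D_def
  proof (intro has_derivative_diff dw has_derivative_const has_derivative_sum
      continuous_scaleR_vanishing_has_derivative dA)
    show "isCont (\<lambda>x. v x \<bullet> b) a" for b
      using cont by (intro continuous_intros)
  qed simp
  have veq: "v x = v a + B (D x)" if "x \<in> S" for x
  proof -
    have "linear (\<lambda>u. A x u - A a u)"
      by (intro linear_compose_sub lin that S(2))
    from linear_basis_expansion[OF this, of "v x"]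
    have "D x = (w x - w a) - (A x (v x) - A a (v x))"
      by (simp add: D_def)
    then have "D x = A a (v x - v a)"
      using eq[OF that] eq[OF S(2)] linear_diff[OF lin[OF S(2)]] by simp
    then have "B (D x) = v x - v a"
      using B(2) by (metis comp_apply id_apply)
    then show ?thesis by simp
  qed
  have expand: "A x u = (\<Sum>b\<in>Basis. (u \<bullet> b) *\<^sub>R A x b)" if "x \<in> S" for x u
    by (rule linear_basis_expansion[OF lin[OF that]])
  define v' where "v' d = 0 + B ((w' d - 0) - (\<Sum>b\<in>Basis. (v a \<bullet> b) *\<^sub>R (A' b d - 0)))" for d
  have "bounded_linear B"
    using B(1) by (simp add: linear_conv_bounded_linear)
  then have "((\<lambda>x. v a + B (D x)) has_derivative v') (at a)"
    unfolding v'_def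
    by (intro has_derivative_add has_derivative_const bounded_linear.has_derivative[OF _ dD])
  then have "(v has_derivative v') (at a)"
    by (rule has_derivative_transform_within_open[OF _ S]) (simp add: veq)
  then show v: "v differentiable (at a)"
    unfolding differentiable_def by blast
  \<comment> \<open>Now the basis expansion of \<open>A x (v x)\<close> can be differentiated by the
    product rule and compared with the derivative of \<open>w\<close>.\<close>
  then have dv: "(v has_derivative frechet_derivative v (at a)) (at a)"
    by (simp add: frechet_derivative_works)
  have "((\<lambda>x. \<Sum>b\<in>Basis. (v x \<bullet> b) *\<^sub>R A x b) has_derivative
     (\<lambda>d. \<Sum>b\<in>Basis. (v a \<bullet> b) *\<^sub>R A' b d + (frechet_derivative v (at a) d \<bullet> b) *\<^sub>R A a b)) (at a)"
    by (intro has_derivative_sum has_derivative_scaleR dA has_derivative_inner_left dv)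
  then have "(w has_derivative
     (\<lambda>d. \<Sum>b\<in>Basis. (v a \<bullet> b) *\<^sub>R A' b d + (frechet_derivative v (at a) d \<bullet> b) *\<^sub>R A a b)) (at a)"
    by (rule has_derivative_transform_within_open[OF _ S]) (simp add: eq expand[symmetric])
  from has_derivative_unique[OF dw this]
  have w': "w' d = (\<Sum>b\<in>Basis. (v a \<bullet> b) *\<^sub>R A' b d) + A a (frechet_derivative v (at a) d)"
    by (simp add: sum.distrib expand[OF S(2), symmetric])
  \<comment> \<open>\<open>A'\<close> is given separately for each fixed vector; uniqueness of
    derivatives identifies its value at \<open>v a\<close> with the basis sum.\<close>
  have "((\<lambda>x. \<Sum>b\<in>Basis. (v a \<bullet> b) *\<^sub>R A x b) has_derivative
     (\<lambda>d. \<Sum>b\<in>Basis. (v a \<bullet> b) *\<^sub>R A' b d)) (at a)"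
    by (intro has_derivative_sum has_derivative_scaleR_right dA)
  then have "((\<lambda>x. A x (v a)) has_derivative (\<lambda>d. \<Sum>b\<in>Basis. (v a \<bullet> b) *\<^sub>R A' b d)) (at a)"
    by (rule has_derivative_transform_within_open[OF _ S]) (rule expand[symmetric])
  from has_derivative_unique[OF dA this]
  have "A' (v a) d = (\<Sum>b\<in>Basis. (v a \<bullet> b) *\<^sub>R A' b d)"
    by simp
  then show "A a (frechet_derivative v (at a) d) = w' d - A' (v a) d"
    using w' by simp
qed

text \<open>The derivative of the solution solves a system with the same matrix and a right-hand side
  involving only the solution itself, so regularity is gained one order at a time.\<close>

lemma Ck_on_linear_solution:
  fixes A :: "'e::euclidean_space \<Rightarrow> 'f::euclidean_space \<Rightarrow> 'g::euclidean_space"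
  assumes S: "open S" and lin: "\<And>x. x \<in> S \<Longrightarrow> linear (A x)" and inj: "\<And>x. x \<in> S \<Longrightarrow> inj (A x)"
    and sA: "\<And>b. smooth_on (\<lambda>x. A x b) S"
    and "Ck_on k w S" "\<And>x. x \<in> S \<Longrightarrow> A x (v x) = w x"
  shows "Ck_on k v S"
  using assms(5,6)
proof (induction k arbitrary: v w)
  case 0
  have "isCont (\<lambda>x. A x b) x" if "x \<in> S" for x b
    using sA[of b] that S continuous_on_eq_continuous_at[OF S]
    unfolding smooth_on_def by (metis Ck_on.simps(1))
  moreover have "isCont w x" if "x \<in> S" for x
    using 0 that continuous_on_eq_continuous_at[OF S] by auto
  ultimately have "isCont v x" if "x \<in> S" for x
    using that by (intro isCont_linear_solution[where A = A and w = w, OF S that lin inj[OF that]] 0(2))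
  then show ?case by (simp add: continuous_at_imp_continuous_on)
next
  case (Suc k)
  define A' where "A' x b = frechet_derivative (\<lambda>x. A x b) (at x)" for x b
  have cA: "Ck_on (Suc j) (\<lambda>x. A x b) S" for j b
    using sA unfolding smooth_on_def by blast
  have dA: "((\<lambda>x. A x b) has_derivative A' x b) (at x)" if "x \<in> S" for x b
    unfolding A'_def using Ck_on_has_derivative[OF cA[of 0] S that] .
  note dw = Ck_on_has_derivative[OF Suc.prems(1) S]
  have sol: "v differentiable (at x)"
    "A x (frechet_derivative v (at x) d) = frechet_derivative w (at x) d - A' x (v x) d"
    if "x \<in> S" for x d
    using has_derivative_linear_solution[where A = A and a = x and A' = "A' x" and w = w and v = v,
        OF S that lin inj[OF that] dA[OF that] dw[OF that] Suc.prems(2)] by auto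
  have Ckv: "Ck_on k v S"
    using Suc.IH Ck_on_Suc_D[OF Suc.prems(1)] Suc.prems(2) by blast
  \<comment> \<open>Linearity of \<open>A x\<close> in \<open>b\<close> survives differentiation in
    \<open>x\<close>; it is needed to insert the varying vector \<open>v x\<close> into
    \<open>A'\<close>.\<close>
  have linA': "linear (\<lambda>b. A' x b d)" if "x \<in> S" for x d
  proof (rule linearI)
    show "A' x (b1 + b2) d = A' x b1 d + A' x b2 d" for b1 b2
    proof -
      have "((\<lambda>x. A x b1 + A x b2) has_derivative A' x (b1 + b2)) (at x)"
        by (rule has_derivative_transform_within_open[OF dA[OF that] S that])
          (simp add: lin linear_add)
      from has_derivative_unique[OF this has_derivative_add[OF dA[OF that] dA[OF that]]]
      show ?thesis by (simp add: fun_eq_iff)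
    qed
    show "A' x (r *\<^sub>R b) d = r *\<^sub>R A' x b d" for r b
    proof -
      have "((\<lambda>x. r *\<^sub>R A x b) has_derivative A' x (r *\<^sub>R b)) (at x)"
        by (rule has_derivative_transform_within_open[OF dA[OF that] S that])
          (simp add: lin linear_scale)
      from has_derivative_unique[OF this has_derivative_scaleR_right[OF dA[OF that]]]
      show ?thesis by (simp add: fun_eq_iff)
    qed
  qed
  have "Ck_on k (\<lambda>x. frechet_derivative v (at x) d) S" for d
  proof (rule Suc.IH)
    have "Ck_on k (\<lambda>x. A' x (v x) d) S"
      by (rule Ck_on_linear_apply[OF S linA' _ Ckv]) (use cA[of k] in \<open>simp_all add: A'_def\<close>)
    then have "Ck_on k (\<lambda>x. frechet_derivative w (at x) d + - A' x (v x) d) S"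
      using Suc.prems(1)
      by (intro Ck_on_add[OF S] Ck_on_bounded_linear[OF bounded_linear_minus[OF bounded_linear_ident] S]) auto
    then show "Ck_on k (\<lambda>x. frechet_derivative w (at x) d - A' x (v x) d) S"
      by simp
    show "A x (frechet_derivative v (at x) d) = frechet_derivative w (at x) d - A' x (v x) d"
      if "x \<in> S" for x
      by (rule sol(2)[OF that])
  qed
  moreover have "v differentiable_on S"
    unfolding differentiable_on_eq_differentiable_at[OF S] using sol(1) by blast
  ultimately show ?case by simp
qed

section \<open>From finite orders to smooth maps\<close>

lemma smooth_on_cong: "open S \<Longrightarrow> (\<And>x. x \<in> S \<Longrightarrow> f x = g x) \<Longrightarrow> smooth_on f S \<longleftrightarrow> smooth_on g S"
  unfolding smooth_on_def using Ck_on_cong[of S f g] by simp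

lemma smooth_on_local:
  assumes "\<And>x. x \<in> S \<Longrightarrow> \<exists>T. open T \<and> x \<in> T \<and> smooth_on f T"
  shows "smooth_on f S"
  unfolding smooth_on_def
proof
  show "Ck_on k f S" for k
    by (rule Ck_on_local) (metis assms smooth_on_def)
qed

lemma smooth_on_const: "open S \<Longrightarrow> smooth_on (\<lambda>x. c) S"
  unfolding smooth_on_def by (simp add: Ck_on_const)

lemma smooth_on_bounded_linear:
  "bounded_linear h \<Longrightarrow> open S \<Longrightarrow> smooth_on f S \<Longrightarrow> smooth_on (\<lambda>x. h (f x)) S"
  unfolding smooth_on_def by (simp add: Ck_on_bounded_linear)

lemma smooth_on_add: "open S \<Longrightarrow> smooth_on f S \<Longrightarrow> smooth_on g S \<Longrightarrow> smooth_on (\<lambda>x. f x + g x) S"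
  unfolding smooth_on_def by (simp add: Ck_on_add)

lemma (in bounded_bilinear) smooth_on_prod:
  "open S \<Longrightarrow> smooth_on f S \<Longrightarrow> smooth_on g S \<Longrightarrow> smooth_on (\<lambda>x. prod (f x) (g x)) S"
  unfolding smooth_on_def by (simp add: Ck_on_prod)

lemma smooth_on_linear_apply:
  fixes L :: "'e::euclidean_space \<Rightarrow> 'f::euclidean_space \<Rightarrow> 'g::real_normed_vector"
  assumes "open S" "\<And>x. x \<in> S \<Longrightarrow> linear (L x)" "\<And>b. smooth_on (\<lambda>x. L x b) S" "smooth_on u S"
  shows "smooth_on (\<lambda>x. L x (u x)) S"
  using assms Ck_on_linear_apply[of S L] unfolding smooth_on_def by blast

lemma smooth_on_compose:
  fixes g :: "'e::euclidean_space \<Rightarrow> 'f::euclidean_space" and f :: "'f \<Rightarrow> 'g::real_normed_vector"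
  assumes "open S" "open T" "g ` S \<subseteq> T" "smooth_on g S" "smooth_on f T"
  shows "smooth_on (f \<circ> g) S"
  using assms Ck_on_compose unfolding smooth_on_def by blast

lemma smooth_on_linear_solution:
  fixes A :: "'e::euclidean_space \<Rightarrow> 'f::euclidean_space \<Rightarrow> 'g::euclidean_space"
  assumes "open S" "\<And>x. x \<in> S \<Longrightarrow> linear (A x)" "\<And>x. x \<in> S \<Longrightarrow> inj (A x)"
    and "\<And>b. smooth_on (\<lambda>x. A x b) S"
    and "smooth_on w S" "\<And>x. x \<in> S \<Longrightarrow> A x (v x) = w x"
  shows "smooth_on v S"
proof -
  have "Ck_on k v S" for k
    by (rule Ck_on_linear_solution[where A = A and w = w]) (use assms in \<open>auto simp: smooth_on_def\<close>)
  then show ?thesis by (simp add: smooth_on_def)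
qed

lemma smooth_on_has_derivative:
  assumes "smooth_on f S" "open S" "x \<in> S"
  shows "(f has_derivative frechet_derivative f (at x)) (at x)"
  using assms(1) Ck_on_has_derivative[OF _ assms(2,3)] unfolding smooth_on_def by blast

lemma smooth_on_frechet_derivative:
  "smooth_on f S \<Longrightarrow> smooth_on (\<lambda>x. frechet_derivative f (at x) v) S"
  unfolding smooth_on_def by (metis Ck_on.simps(2))

section \<open>Signatures\<close>

text \<open>A positive and a negative definite subspace meet only in zero. This is the bound that
  pins down a signature.\<close>

lemma definite_subspaces_dim_le:
  fixes P Q :: "'e::euclidean_space set"
  assumes "subspace P" "\<And>v. v \<in> P \<Longrightarrow> v \<noteq> 0 \<Longrightarrow> B v v > (0::real)"
    and "subspace Q" "\<And>v. v \<in> Q \<Longrightarrow> v \<noteq> 0 \<Longrightarrow> B v v < 0"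
  shows "dim P + dim Q \<le> DIM('e)"
proof -
  have "P \<inter> Q \<subseteq> {0}"
    using assms(2,4) by (metis IntD1 IntD2 less_asym singletonI subsetI)
  then have "dim (P \<inter> Q) = 0"
    by simp
  then have "dim P + dim Q = dim {x + y |x y. x \<in> P \<and> y \<in> Q}"
    using dim_sums_Int[OF assms(1,3)] by linarith
  then show ?thesis
    by (simp add: dim_subset_UNIV)
qed

lemma orthogonal_complement_dim_ge:
  fixes P :: "'e::euclidean_space set" and B :: "'e \<Rightarrow> 'e \<Rightarrow> real"
  assumes B: "bilinear B"
  shows "DIM('e) \<le> dim P + dim {v. \<forall>w\<in>P. B w v = 0}"
proof -
  define L where "L w = (\<Sum>b\<in>Basis. B w b *\<^sub>R b)" for w
  have lin: "linear L"
    unfolding L_def using B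
    by (intro linear_compose_sum ballI) (auto simp: bilinear_def linear_iff scaleR_add_left)
  have L: "L w \<bullet> v = B w v" for w v
  proof -
    have "linear (B w)" using B by (simp add: bilinear_def)
    then have "B w v = (\<Sum>b\<in>Basis. (v \<bullet> b) *\<^sub>R B w b)"
      using linear_sum[of "B w"] linear_scale[of "B w"]
      by (metis (no_types, lifting) euclidean_representation sum.cong)
    then show ?thesis
      by (simp add: L_def inner_sum_left mult.commute inner_commute[of v])
  qed
  have "dim {y \<in> UNIV. \<forall>x\<in>span (L ` P). orthogonal x y} + dim (span (L ` P)) = dim (UNIV :: 'e set)"
    by (rule dim_subspace_orthogonal_to_vectors) auto
  moreover have "{y \<in> UNIV. \<forall>x\<in>span (L ` P). orthogonal x y} \<subseteq> {v. \<forall>w\<in>P. B w v = 0}"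
    using L span_base[of _ "L ` P"] by (fastforce simp: orthogonal_def)
  ultimately show ?thesis
    using dim_image_le[OF lin, of P] dim_subset[of "{y \<in> UNIV. \<forall>x\<in>span (L ` P). orthogonal x y}"]
    by (metis (no_types, lifting) add.commute add_mono dim_UNIV dim_span)
qed

text \<open>Take a positive definite \<open>P\<close> of greatest dimension and let \<open>Q\<close>
  be its \<open>B\<close>-complement. Maximality excludes positive vectors in \<open>Q\<close>; a
  null vector of \<open>Q\<close> would be orthogonal to \<open>Q\<close> and to \<open>P\<close>,
  hence to everything.\<close>

lemma nondegenerate_has_signature:
  fixes B :: "'e::euclidean_space \<Rightarrow> 'e \<Rightarrow> real"
  assumes B: "bilinear B" and sym: "\<And>u v. B u v = B v u"
    and nondeg: "\<And>u. (\<And>v. B u v = 0) \<Longrightarrow> u = 0"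
  obtains r s where "has_signature B r s"
proof -
  note simps = bilinear_ladd[OF B] bilinear_radd[OF B] bilinear_lmul[OF B] bilinear_rmul[OF B]
    bilinear_lzero[OF B] bilinear_rzero[OF B]
  define pos where "pos P \<longleftrightarrow> subspace P \<and> (\<forall>v\<in>P. v \<noteq> 0 \<longrightarrow> B v v > 0)" for P
  have "pos {0}" by (simp add: pos_def)
  then obtain P where P: "pos P" "\<And>P'. pos P' \<Longrightarrow> dim P' \<le> dim P"
    using ex_has_greatest_nat[of pos "{0}" dim "Suc DIM('e)"] by (auto simp: dim_subset_UNIV less_Suc_eq_le)
  have subP: "subspace P" using P(1) by (simp add: pos_def)
  define Q where "Q = {v. \<forall>w\<in>P. B w v = 0}"
  have subQ: "subspace Q"
    by (auto simp: Q_def subspace_def simps)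
  have "P \<inter> Q \<subseteq> {0}"
  proof
    fix v assume "v \<in> P \<inter> Q"
    then have "v \<in> P" "B v v = 0" by (auto simp: Q_def)
    then show "v \<in> {0}" using P(1) by (auto simp: pos_def)
  qed
  then have "dim (P \<inter> Q) = 0"
    by simp
  then have dimPQ: "dim {x + y |x y. x \<in> P \<and> y \<in> Q} = dim P + dim Q"
    using dim_sums_Int[OF subP subQ] by linarith
  then have dims: "dim P + dim Q = DIM('e)"
    using orthogonal_complement_dim_ge[OF B, of P] dim_subset_UNIV[of "{x + y |x y. x \<in> P \<and> y \<in> Q}"]
    by (simp add: Q_def)
  have PQ: "{x + y |x y. x \<in> P \<and> y \<in> Q} = UNIV"
    using dimPQ dims subspace_sums[OF subP subQ] by (simp add: dim_eq_full span_eq_iff[THEN iffD2])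
  have nonpos: "B v v \<le> 0" if "v \<in> Q" for v
  proof (rule ccontr)
    assume "\<not> B v v \<le> 0"
    then have vpos: "B v v > 0" by simp
    \<comment> \<open>Adjoining the positive vector \<open>v\<close>, which is orthogonal to
      \<open>P\<close>, would contradict the maximality of \<open>P\<close>.\<close>
    have "pos (span (insert v P))"
      unfolding pos_def
    proof (intro conjI ballI impI)
      fix u assume "u \<in> span (insert v P)" "u \<noteq> 0"
      then obtain t where "u - t *\<^sub>R v \<in> P"
        using span_breakdown_eq span_eq_iff subP by blast
      then obtain w where w: "w \<in> P" "u = w + t *\<^sub>R v"
        by (metis diff_add_cancel)
      then have "B w v = 0" "B v w = 0"
        using that sym by (auto simp: Q_def)
      then have "B u u = B w w + t * (t * B v v)"
        using w by (simp add: simps)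
      moreover have "B w w \<ge> 0"
        using w(1) P(1) by (cases "w = 0") (auto simp: pos_def simps less_imp_le)
      moreover have "B w w > 0 \<or> t \<noteq> 0"
        using \<open>u \<noteq> 0\<close> w P(1) by (cases "w = 0") (auto simp: pos_def)
      moreover have "t * (t * B v v) > 0" if "t \<noteq> 0"
        using vpos that by (simp add: zero_less_mult_iff mult_less_0_iff) linarith
      ultimately show "0 < B u u"
        by (cases "t = 0") auto
    qed simp
    moreover have "v \<notin> span P"
    proof
      assume "v \<in> span P"
      then have "v \<in> P" using subP by (simp add: span_eq_iff[THEN iffD2])
      then show False using that vpos by (auto simp: Q_def)
    qed
    ultimately show False
      using P(2)[of "span (insert v P)"] by (simp add: dim_insert)
  qed
  have neg: "B v v < 0" if v: "v \<in> Q" "v \<noteq> 0" for v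
  proof (rule ccontr)
    assume "\<not> B v v < 0"
    then have vv: "B v v = 0" using nonpos[OF v(1)] by simp
    have "B v w = 0" if w: "w \<in> Q" for w
    proof (rule ccontr)
      assume nz: "B v w \<noteq> 0"
      \<comment> \<open>As \<open>v\<close> is null, \<open>B\<close> is affine along the line
        through \<open>w\<close> in direction \<open>v\<close>; this \<open>t\<close> makes its
        value 1, although it is nonpositive on \<open>Q\<close>.\<close>
      define t where "t = (1 - B w w) / (2 * B v w)"
      have "w + t *\<^sub>R v \<in> Q"
        using subQ v(1) w by (simp add: subspace_add subspace_mul)
      then have "B (w + t *\<^sub>R v) (w + t *\<^sub>R v) \<le> 0" by (rule nonpos)
      moreover have "B (w + t *\<^sub>R v) (w + t *\<^sub>R v) = B w w + t * (2 * B v w)"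
        using vv sym[of w v] by (simp add: simps)
      ultimately show False using nz by (simp add: t_def)
    qed
    moreover have "B v w = 0" if "w \<in> P" for w
      using that v(1) sym by (auto simp: Q_def)
    moreover have "\<exists>x\<in>P. \<exists>y\<in>Q. u = x + y" for u
      using PQ by blast
    ultimately have "B v u = 0" for u
      by (metis add.right_neutral bilinear_radd[OF B])
    then show False using nondeg v(2) by blast
  qed
  have "has_signature B (dim P) (dim Q)"
    unfolding has_signature_def using dims P(1) subQ neg unfolding pos_def by blast
  then show thesis by (rule that)
qed

text \<open>The image of \<open>P\<close> under \<open>J\<close> is enlarged by a vector of the same
  sign orthogonal to the range of \<open>J\<close>. The factor \<open>sg\<close>, used with 1 and
  -1, treats both signs at once.\<close>

lemma definite_image_extension:
  fixes J :: "'f::euclidean_space \<Rightarrow> 'e::euclidean_space" and B :: "'e \<Rightarrow> 'e \<Rightarrow> real"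
  assumes B: "bilinear B" and sym: "\<And>u v. B u v = B v u"
    and J: "linear J" "inj J" and nJ: "\<And>x. B nu (J x) = 0"
    and P: "subspace P" "\<And>v. v \<in> P \<Longrightarrow> v \<noteq> 0 \<Longrightarrow> sg * B (J v) (J v) > 0" and nu: "sg * B nu nu > 0"
  shows "\<exists>P'. subspace P' \<and> dim P' = dim P + 1 \<and> (\<forall>v\<in>P'. v \<noteq> 0 \<longrightarrow> sg * B v v > 0)"
proof (intro exI conjI ballI impI)
  note simps = bilinear_ladd[OF B] bilinear_radd[OF B] bilinear_lmul[OF B] bilinear_rmul[OF B]
    bilinear_lzero[OF B] bilinear_rzero[OF B]
  let ?P = "span (insert nu (J ` P))"
  have sJ: "span (J ` P) = J ` P"
    using linear_subspace_image[OF J(1) P(1)] by (simp add: span_eq_iff)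
  have "nu \<notin> span (J ` P)"
    using nJ nu unfolding sJ by force
  then show "dim ?P = dim P + 1"
    using dim_image_eq[OF J(1)] J(2) by (simp add: dim_insert inj_on_subset)
  show "sg * B u u > 0" if u: "u \<in> ?P" "u \<noteq> 0" for u
  proof -
    from u obtain t where "u - t *\<^sub>R nu \<in> J ` P"
      using span_breakdown_eq sJ by blast
    then obtain w where w: "w \<in> P" "u = J w + t *\<^sub>R nu"
      by (metis diff_add_cancel imageE)
    then have "B u u = B (J w) (J w) + t * (t * B nu nu)"
      using nJ[of w] sym[of "J w" nu] by (simp add: simps)
    then have e: "sg * B u u = sg * B (J w) (J w) + t * t * (sg * B nu nu)"
      by (simp add: algebra_simps)
    show ?thesis
    proof (cases "w = 0")
      case True
      then have "t \<noteq> 0" using u(2) w(2) linear_0[OF J(1)] by auto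
      then have "t * t > 0" by (simp add: zero_less_mult_iff) linarith
      then show ?thesis
        using True unfolding e by (simp add: linear_0[OF J(1)] simps mult_pos_pos nu)
    next
      case False
      then show ?thesis using e P(2)[OF w(1)] nu by (simp add: add_pos_nonneg)
    qed
  qed
qed simp

text \<open>The pulled back form has some signature \<open>(r', s')\<close>. Adjoining
  \<open>n1\<close> and \<open>n2\<close> yields definite subspaces of dimensions
  \<open>r' + 1\<close> and \<open>s' + 1\<close>, and counting dimensions determines both numbers.
  The answer depends only on \<open>r\<close> and \<open>s\<close>, hence is constant along the
  submanifold.\<close>

lemma has_signature_codim2:
  fixes J :: "'f::euclidean_space \<Rightarrow> 'e::euclidean_space" and B :: "'e \<Rightarrow> 'e \<Rightarrow> real"
  assumes B: "bilinear B" and sym: "\<And>u v. B u v = B v u" and sig: "has_signature B r s"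
    and J: "linear J" "inj J" and orth: "\<And>x. B n1 (J x) = 0" "\<And>x. B n2 (J x) = 0"
    and n: "B n1 n1 > 0" "B n2 n2 < 0"
    and nondeg: "\<And>u. (\<And>v. B (J u) (J v) = 0) \<Longrightarrow> u = 0"
    and dims: "DIM('e) = DIM('f) + 2"
  shows "has_signature (\<lambda>u v. B (J u) (J v)) (r - 1) (s - 1)"
proof -
  have "bilinear (\<lambda>u v. B (J u) (J v))"
    using B J(1) by (auto simp: bilinear_def linear_iff)
  then obtain r' s' where sig': "has_signature (\<lambda>u v. B (J u) (J v)) r' s'"
    using nondegenerate_has_signature sym nondeg by blast
  obtain P' Q' where PQ': "subspace P'" "dim P' = r'" "\<And>v. v \<in> P' \<Longrightarrow> v \<noteq> 0 \<Longrightarrow> B (J v) (J v) > 0"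
    "subspace Q'" "dim Q' = s'" "\<And>v. v \<in> Q' \<Longrightarrow> v \<noteq> 0 \<Longrightarrow> B (J v) (J v) < 0" "r' + s' = DIM('f)"
    using sig' unfolding has_signature_def by auto
  obtain P Q where PQ: "subspace P" "dim P = r" "\<And>v. v \<in> P \<Longrightarrow> v \<noteq> 0 \<Longrightarrow> B v v > 0"
    "subspace Q" "dim Q = s" "\<And>v. v \<in> Q \<Longrightarrow> v \<noteq> 0 \<Longrightarrow> B v v < 0" "r + s = DIM('e)"
    using sig unfolding has_signature_def by auto
  obtain P1 where P1: "subspace P1" "dim P1 = r' + 1" "\<And>v. v \<in> P1 \<Longrightarrow> v \<noteq> 0 \<Longrightarrow> B v v > 0"
    using definite_image_extension[OF B sym J orth(1) PQ'(1), of 1] PQ'(2,3) n by auto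
  obtain Q1 where Q1: "subspace Q1" "dim Q1 = s' + 1" "\<And>v. v \<in> Q1 \<Longrightarrow> v \<noteq> 0 \<Longrightarrow> B v v < 0"
    using definite_image_extension[OF B sym J orth(2) PQ'(4), of "-1"] PQ'(5,6) n by auto
  have "r' + 1 + s \<le> r + s" "r + (s' + 1) \<le> r + s"
    using definite_subspaces_dim_le[where B = B, OF P1(1,3) PQ(4,6)]
      definite_subspaces_dim_le[where B = B, OF PQ(1,3) Q1(1,3)]
    unfolding P1(2) Q1(2) PQ(2,5,7) by simp_all
  \<comment> \<open>The two bounds give \<open>r' + 1 \<le> r\<close> and
    \<open>s' + 1 \<le> s\<close>, so the subtractions on naturals are genuine; equality follows
    from the sum of the dimensions.\<close>
  then have "r' = r - 1" "s' = s - 1"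
    using dims PQ(7) PQ'(7) by linarith+
  then show ?thesis using sig' by simp
qed

section \<open>Linear algebra at a point\<close>

text \<open>From \<open>f (f xi) = 0\<close> the structure equation makes \<open>f xi\<close> a
  multiple of \<open>xi\<close>, and applying \<open>f\<close> again makes it zero. The other two
  claims come from the Norden identity with \<open>Y\<close> replaced by \<open>xi\<close> and by
  \<open>f Y\<close>.\<close>

lemma norden_structure_facts:
  fixes f :: "'e::real_vector \<Rightarrow> 'e" and G :: "'e \<Rightarrow> 'e \<Rightarrow> real"
  assumes lin: "linear f" and G: "bilinear G" and sym: "\<And>u v. G u v = G v u"
    and ff: "\<And>X. f (f X) = - X + et X *\<^sub>R xi" and et: "et xi = 1"
    and Gf: "\<And>X Y. G (f X) (f Y) = - G X Y + et X * et Y"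
  shows "f xi = 0" "et X = G X xi" "G (f X) Y = G X (f Y)"
proof -
  note simps = bilinear_ladd[OF G] bilinear_radd[OF G] bilinear_lmul[OF G] bilinear_rmul[OF G]
    bilinear_lzero[OF G] bilinear_rzero[OF G] bilinear_lneg[OF G] bilinear_rneg[OF G]
    bilinear_lsub[OF G] bilinear_rsub[OF G]
  have xi: "xi \<noteq> 0"
  proof
    assume "xi = 0"
    moreover have "f 0 = 0" using lin by (rule linear_0)
    moreover have "G 0 0 = 0" by (rule bilinear_lzero[OF G])
    ultimately show False using Gf[of xi xi] et by simp
  qed
  have ffxi: "f (f xi) = 0" using ff[of xi] et by simp
  have "f (f (f xi)) = 0" using ffxi linear_0[OF lin] by simp
  then have fxi: "f xi = et (f xi) *\<^sub>R xi" using ff[of "f xi"] by simp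
  then have "et (f xi) *\<^sub>R f xi = 0" using ffxi linear_scale[OF lin] by metis
  then show fxi0: "f xi = 0"
    using fxi by (metis scaleR_eq_0_iff)
  \<comment> \<open>Computing the third power of \<open>f\<close> as \<open>f\<close> after its
    square and as its square after \<open>f\<close> leaves
    \<open>et (f X) *\<^sub>R xi = 0\<close>.\<close>
  have etf: "et (f X) = 0" for X
  proof -
    have "f (f (f X)) = - f X"
      using ff[of X] fxi0 by (simp add: linear_add[OF lin] linear_neg[OF lin] linear_scale[OF lin] linear_diff[OF lin])
    then show ?thesis using ff[of "f X"] xi by simp
  qed
  show "et X = G X xi" for X
    using Gf[of X xi] fxi0 et by (simp add: simps)
  then show "G (f X) Y = G X (f Y)"
    using Gf[of X "f Y"] etf[of Y] etf[of X] ff[of Y] by (simp add: simps)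
qed

text \<open>The data of the theorem frozen at one point: \<open>f\<close>, \<open>xb\<close>,
  \<open>eb\<close>, \<open>G\<close> form the ambient structure, \<open>J\<close> is the
  differential of the inclusion, and the remaining vectors, maps and scalars are the parts of the
  given decompositions.\<close>

locale norden_codim2 =
  fixes f :: "'e::real_vector \<Rightarrow> 'e" and xb :: 'e and eb :: "'e \<Rightarrow> real"
    and G :: "'e \<Rightarrow> 'e \<Rightarrow> real"
    and J :: "'f::real_vector \<Rightarrow> 'e" and n1 n2 :: 'e
    and x0 x1 x2 :: 'f and ph :: "'f \<Rightarrow> 'f" and e1 e2 :: "'f \<Rightarrow> real" and a b k :: real
  assumes lin_f: "linear f" and bil: "bilinear G" and sym: "G u v = G v u"
    and ff: "f (f X) = - X + eb X *\<^sub>R xb" and eb_xb: "eb xb = 1"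
    and Gf: "G (f X) (f Y) = - G X Y + eb X * eb Y"
    and lin_J: "linear J" and inj_J: "inj J"
    and orth1: "G n1 (J x) = 0" and orth2: "G n2 (J x) = 0"
    and n11: "G n1 n1 = 1" and n22: "G n2 n2 = - 1" and n12: "G n1 n2 = 0"
    and xb_eq: "xb = J x0 + a *\<^sub>R n1 + b *\<^sub>R n2"
    and fJ: "f (J x) = J (ph x) + e1 x *\<^sub>R n1 + e2 x *\<^sub>R n2"
    and fn1: "f n1 = J x1" and fn2: "f n2 = - J x2"
    and kk: "a\<^sup>2 - b\<^sup>2 = k\<^sup>2" and k0: "k \<noteq> 0"
begin

lemmas bil_simps = bilinear_ladd[OF bil] bilinear_radd[OF bil] bilinear_lmul[OF bil]
  bilinear_rmul[OF bil] bilinear_lzero[OF bil] bilinear_rzero[OF bil] bilinear_lneg[OF bil]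
  bilinear_rneg[OF bil] bilinear_lsub[OF bil] bilinear_rsub[OF bil]

lemmas orth_simps = orth1 orth2 orth1[unfolded sym[of n1]] orth2[unfolded sym[of n2]]
  n11 n22 n12 n12[unfolded sym[of n1]]

lemmas lin_simps = linear_add[OF lin_f] linear_neg[OF lin_f] linear_scale[OF lin_f]
  linear_add[OF lin_J] linear_neg[OF lin_J] linear_scale[OF lin_J] linear_diff[OF lin_J]

abbreviation h :: "'f \<Rightarrow> 'f \<Rightarrow> real" where "h x y \<equiv> G (J x) (J y)"

lemma f_xb: "f xb = 0" and eb_eq: "eb X = G X xb" and f_selfadj: "G (f X) Y = G X (f Y)"
  using norden_structure_facts[OF lin_f bil sym ff eb_xb Gf] by auto

text \<open>Pairing with \<open>n1\<close> and \<open>n2\<close> reads off the normal coefficients,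
  with a sign for the negative vector \<open>n2\<close>; injectivity of \<open>J\<close> gives the
  tangential part. Every structure equation below is split by this lemma.\<close>

lemma components_unique:
  assumes "J x + r *\<^sub>R n1 + s *\<^sub>R n2 = J y + r' *\<^sub>R n1 + s' *\<^sub>R n2"
  shows "x = y" "r = r'" "s = s'"
proof -
  have "G n1 (J x + r *\<^sub>R n1 + s *\<^sub>R n2) = r" "G n1 (J y + r' *\<^sub>R n1 + s' *\<^sub>R n2) = r'"
    "G n2 (J x + r *\<^sub>R n1 + s *\<^sub>R n2) = - s" "G n2 (J y + r' *\<^sub>R n1 + s' *\<^sub>R n2) = - s'"
    by (simp_all add: bil_simps orth_simps)
  then show r: "r = r'" and s: "s = s'" using assms by auto
  then have "J x = J y" using assms by simp
  then show "x = y" using inj_J by (simp add: inj_eq)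
qed

text \<open>Together with \<open>e1_eq\<close> and \<open>e2_eq\<close>, these formulas express the
  normal coefficients through the ambient metric, from which their smoothness is derived
  later.\<close>

lemma a_eq: "a = G xb n1" and b_eq: "b = - G xb n2"
  unfolding xb_eq by (simp_all add: bil_simps orth_simps)

lemma e1_eq: "e1 x = G (f (J x)) n1" and e2_eq: "e2 x = - G (f (J x)) n2"
  unfolding fJ by (simp_all add: bil_simps orth_simps)

text \<open>Self-adjointness moves \<open>f\<close> onto the normals. The minus signs from
  \<open>G n2 n2\<close> and from \<open>f n2\<close> cancel.\<close>

lemma e1_h: "e1 x = h x x1" and e2_h: "e2 x = h x x2"
  unfolding e1_eq e2_eq f_selfadj fn1 fn2 by (simp_all add: bil_simps)

lemma linear_e1: "linear e1" and linear_e2: "linear e2"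
  unfolding e1_h[abs_def] e2_h[abs_def]
  by (auto simp: linear_iff lin_simps bil_simps)

lemma linear_ph: "linear ph"
proof (rule linearI)
  show "ph (x + y) = ph x + ph y" for x y
  proof (rule components_unique(1))
    show "J (ph (x + y)) + e1 (x + y) *\<^sub>R n1 + e2 (x + y) *\<^sub>R n2 =
        J (ph x + ph y) + (e1 x + e1 y) *\<^sub>R n1 + (e2 x + e2 y) *\<^sub>R n2"
      using fJ[of "x + y"] fJ[of x] fJ[of y] by (simp add: lin_simps algebra_simps)
  qed
  show "ph (r *\<^sub>R x) = r *\<^sub>R ph x" for r x
  proof (rule components_unique(1))
    show "J (ph (r *\<^sub>R x)) + e1 (r *\<^sub>R x) *\<^sub>R n1 + e2 (r *\<^sub>R x) *\<^sub>R n2 =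
        J (r *\<^sub>R ph x) + (r * e1 x) *\<^sub>R n1 + (r * e2 x) *\<^sub>R n2"
      using fJ[of "r *\<^sub>R x"] fJ[of x] by (simp add: lin_simps algebra_simps)
  qed
qed

lemmas ph_simps = linear_add[OF linear_ph] linear_neg[OF linear_ph] linear_scale[OF linear_ph]
  linear_diff[OF linear_ph] linear_0[OF linear_ph]

lemma ph_selfadj: "h (ph x) y = h x (ph y)"
proof -
  have "G (f (J x)) (J y) = h (ph x) y" "G (J x) (f (J y)) = h x (ph y)"
    unfolding fJ by (simp_all add: bil_simps orth_simps)
  then show ?thesis using f_selfadj by simp
qed

text \<open>The three parts of \<open>f xb = 0\<close>.\<close>

lemma ph_x0: "ph x0 = - a *\<^sub>R x1 + b *\<^sub>R x2"
  and e1_x0: "e1 x0 = 0" and e2_x0: "e2 x0 = 0"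
proof -
  have "J (ph x0 + a *\<^sub>R x1 - b *\<^sub>R x2) + e1 x0 *\<^sub>R n1 + e2 x0 *\<^sub>R n2 = J 0 + 0 *\<^sub>R n1 + 0 *\<^sub>R n2"
    using f_xb unfolding xb_eq by (simp add: lin_simps fJ fn1 fn2 linear_0[OF lin_J] algebra_simps)
  note * = components_unique[OF this]
  show "e1 x0 = 0" "e2 x0 = 0" using *(2,3) by auto
  show "ph x0 = - a *\<^sub>R x1 + b *\<^sub>R x2" using *(1) by (simp add: algebra_simps eq_neg_iff_add_eq_0)
qed

text \<open>The three parts of the structure equation at \<open>n1\<close>, where
  \<open>eb n1 = a\<close>; the lemma on \<open>x2\<close> does the same at \<open>n2\<close>, where
  \<open>eb n2 = - b\<close>.\<close>

lemma ph_x1: "ph x1 = a *\<^sub>R x0" and e1_x1: "e1 x1 = a\<^sup>2 - 1" and e2_x1: "e2 x1 = a * b"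
proof -
  have "J (ph x1) + e1 x1 *\<^sub>R n1 + e2 x1 *\<^sub>R n2 = J (a *\<^sub>R x0) + (a\<^sup>2 - 1) *\<^sub>R n1 + (a * b) *\<^sub>R n2"
    using ff[of n1] unfolding fn1 fJ eb_eq sym[of n1] a_eq[symmetric]
    by (simp add: xb_eq lin_simps algebra_simps power2_eq_square)
  from components_unique[OF this] show "ph x1 = a *\<^sub>R x0" "e1 x1 = a\<^sup>2 - 1" "e2 x1 = a * b" by auto
qed

lemma ph_x2: "ph x2 = b *\<^sub>R x0" and e1_x2: "e1 x2 = a * b" and e2_x2: "e2 x2 = 1 + b\<^sup>2"
proof -
  have eb: "eb n2 = - b" unfolding eb_eq sym[of n2] b_eq by simp
  have "J (ph x2) + e1 x2 *\<^sub>R n1 + e2 x2 *\<^sub>R n2 = n2 + b *\<^sub>R xb"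
    using ff[of n2] unfolding fn2 linear_neg[OF lin_f] fJ eb
    by (simp add: algebra_simps neg_eq_iff_add_eq_0)
  also have "\<dots> = J (b *\<^sub>R x0) + (a * b) *\<^sub>R n1 + (1 + b\<^sup>2) *\<^sub>R n2"
    by (simp add: xb_eq lin_simps algebra_simps power2_eq_square)
  finally show "ph x2 = b *\<^sub>R x0" "e1 x2 = a * b" "e2 x2 = 1 + b\<^sup>2"
    using components_unique by blast+
qed

lemma eb_J: "eb (J x) = h x x0"
  unfolding eb_eq xb_eq by (simp add: bil_simps orth_simps)

lemma ph_ph: "ph (ph x) = - x + h x x0 *\<^sub>R x0 - e1 x *\<^sub>R x1 + e2 x *\<^sub>R x2"
proof -
  have "J (ph (ph x) + e1 x *\<^sub>R x1 - e2 x *\<^sub>R x2) + e1 (ph x) *\<^sub>R n1 + e2 (ph x) *\<^sub>R n2 =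
      J (- x + h x x0 *\<^sub>R x0) + (h x x0 * a) *\<^sub>R n1 + (h x x0 * b) *\<^sub>R n2"
    using ff[of "J x"] unfolding eb_J fJ
    by (simp add: xb_eq lin_simps fJ fn1 fn2 algebra_simps)
  from components_unique(1)[OF this] show ?thesis by (simp add: algebra_simps)
qed

text \<open>The normal part of \<open>xb\<close> has square \<open>a^2 - b^2 = k^2\<close>, and
  \<open>xb\<close> itself has square 1.\<close>

lemma h_x0_x0: "h x0 x0 = 1 - k\<^sup>2"
  using eb_xb kk unfolding eb_eq
  by (simp add: xb_eq bil_simps orth_simps power2_eq_square)

text \<open>\<open>ph\<close> sends \<open>x1\<close> and \<open>x2\<close> to
  \<open>a *\<^sub>R x0\<close> and \<open>b *\<^sub>R x0\<close>, so this combination lies in its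
  kernel. Division by \<open>k\<close> normalises it to \<open>et xt = 1\<close>.\<close>

definition xt :: 'f where "xt = - (b / k) *\<^sub>R x1 + (a / k) *\<^sub>R x2"
definition et :: "'f \<Rightarrow> real" where "et x = - (b / k) * e1 x + (a / k) * e2 x"

lemma et_h: "et x = h x xt"
  unfolding et_def xt_def e1_h e2_h by (simp add: lin_simps bil_simps)

lemma linear_et: "linear et"
  unfolding et_h[abs_def] by (auto simp: linear_iff lin_simps bil_simps)

lemma et_xt: "et xt = 1"
proof -
  have "et xt = (a\<^sup>2 - b\<^sup>2) / k\<^sup>2"
    unfolding et_def xt_def using k0
    by (simp add: linear_add[OF linear_e1] linear_scale[OF linear_e1] linear_diff[OF linear_e1]
        linear_add[OF linear_e2] linear_scale[OF linear_e2] linear_diff[OF linear_e2]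
        e1_x1 e1_x2 e2_x1 e2_x2 field_simps power2_eq_square)
  then show ?thesis using kk k0 by simp
qed

lemma ph_xt: "ph xt = 0"
  unfolding xt_def by (simp add: ph_simps ph_x1 ph_x2)

text \<open>Working with \<open>T\<close> instead of splitting into the eigenspaces of \<open>\<phi>\<^sup>2\<close> covers the degenerate case
  \<open>k\<^sup>2 = 1\<close>, in which \<open>\<xi>\<^sub>0\<close> is null.\<close>

definition T :: "'f \<Rightarrow> 'f" where
  "T x = h x x0 *\<^sub>R x0 - (h x (ph x0) / k\<^sup>2) *\<^sub>R ph x0"

lemma linear_T: "linear T"
  unfolding T_def[abs_def]
  by (auto simp: linear_iff lin_simps bil_simps algebra_simps add_divide_distrib)

lemmas T_simps = linear_add[OF linear_T] linear_neg[OF linear_T] linear_scale[OF linear_T]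
  linear_diff[OF linear_T] linear_0[OF linear_T]

text \<open>The \<open>x1\<close>, \<open>x2\<close> terms of \<open>ph_ph\<close> are re-expanded
  along \<open>xt\<close> and \<open>ph x0\<close>, which are combinations of the same two vectors;
  the coefficients match because \<open>a^2 - b^2 = k^2\<close>.\<close>

lemma ph_ph_T: "ph (ph x) = - x + et x *\<^sub>R xt + T x"
proof -
  define p where "p = e1 x"
  define q where "q = e2 x"
  have r: "h x (ph x0) = - a * p + b * q"
    unfolding ph_x0 p_def q_def e1_h e2_h by (simp add: lin_simps bil_simps)
  have d: "b * b - a * a = - (k\<^sup>2)" using kk by (simp add: power2_eq_square)
  have "(b * b * p - a * b * q) - (a * a * p - a * b * q) = (b * b - a * a) * p"
    "(a * a * q - a * b * p) - (b * b * q - a * b * p) = - (b * b - a * a) * q"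
    by (simp_all add: algebra_simps)
  then have c: "(b * b * p - a * b * q) / k\<^sup>2 - (a * a * p - a * b * q) / k\<^sup>2 = - p"
    "(a * a * q - a * b * p) / k\<^sup>2 - (b * b * q - a * b * p) / k\<^sup>2 = q"
    using k0 unfolding d by (simp_all flip: diff_divide_distrib)
  have "et x *\<^sub>R xt - (h x (ph x0) / k\<^sup>2) *\<^sub>R ph x0 =
      ((b * b * p - a * b * q) / k\<^sup>2 - (a * a * p - a * b * q) / k\<^sup>2) *\<^sub>R x1 +
      ((a * a * q - a * b * p) / k\<^sup>2 - (b * b * q - a * b * p) / k\<^sup>2) *\<^sub>R x2"
    unfolding r unfolding ph_x0 xt_def et_def p_def[symmetric] q_def[symmetric]
    by (simp add: algebra_simps power2_eq_square diff_divide_distrib add_divide_distrib)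
  then have "- e1 x *\<^sub>R x1 + e2 x *\<^sub>R x2 = et x *\<^sub>R xt - (h x (ph x0) / k\<^sup>2) *\<^sub>R ph x0"
    unfolding c by (simp add: p_def q_def)
  then show ?thesis unfolding ph_ph T_def by (simp add: algebra_simps)
qed

lemma ph_ph_x0: "ph (ph x0) = - (k\<^sup>2) *\<^sub>R x0"
  unfolding ph_x0 kk[symmetric] by (simp add: ph_simps ph_x1 ph_x2 power2_eq_square algebra_simps)

text \<open>\<open>ph\<close> maps \<open>x0\<close> to \<open>ph x0\<close> and back with factor
  \<open>- k^2\<close>. The weight \<open>1 / k^2\<close> in \<open>T\<close> compensates exactly
  for this.\<close>

lemma T_ph: "T (ph x) = ph (T x)"
  unfolding T_def using k0
  by (simp add: ph_simps ph_selfadj ph_ph_x0 bil_simps lin_simps)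

lemma h_x0_ph_x0: "h x0 (ph x0) = 0"
  unfolding ph_x0 using e1_x0 e2_x0 by (simp add: e1_h e2_h lin_simps bil_simps)

text \<open>\<open>x0\<close> and \<open>ph x0\<close> span the image of \<open>T\<close>, and
  \<open>T\<close> multiplies both by \<open>h x0 x0 = 1 - k^2\<close>.\<close>

lemma T_T: "T (T x) = (1 - k\<^sup>2) *\<^sub>R T x"
proof -
  have x0: "T x0 = (1 - k\<^sup>2) *\<^sub>R x0"
    unfolding T_def by (simp add: h_x0_x0 h_x0_ph_x0)
  then have "T (ph x0) = (1 - k\<^sup>2) *\<^sub>R ph x0"
    by (simp add: T_ph ph_simps)
  then show ?thesis unfolding T_def[of x]
    by (simp add: T_simps x0 scaleR_diff_right mult.commute)
qed

lemma et_ph: "et (ph x) = 0"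
  by (simp add: et_h ph_selfadj ph_xt linear_0[OF lin_J] bil_simps)

text \<open>Applying \<open>et\<close> to \<open>ph_ph_T\<close> leaves only this term, since
  \<open>et\<close> vanishes on the image of \<open>ph\<close> and \<open>et xt = 1\<close>.\<close>

lemma et_T: "et (T x) = 0"
proof -
  have "et (ph (ph x)) = - et x + et x * et xt + et (T x)"
    unfolding ph_ph_T by (simp add: linear_add[OF linear_et] linear_neg[OF linear_et]
        linear_diff[OF linear_et] linear_scale[OF linear_et])
  then show ?thesis by (simp add: et_ph et_xt)
qed

context
  fixes lam mu :: real
  assumes coeff1: "(mu - lam)\<^sup>2 = 1"
    and coeff2: "k\<^sup>2 * lam * (2 * mu - lam - lam * k\<^sup>2) = 1"
begin

definition Ph :: "'f \<Rightarrow> 'f" where "Ph x = lam *\<^sub>R ph (ph (ph x)) + mu *\<^sub>R ph x"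

lemma linear_Ph: "linear Ph"
  unfolding Ph_def[abs_def] by (auto simp: linear_iff ph_simps algebra_simps)

lemma Ph_eq: "Ph x = ph ((mu - lam) *\<^sub>R x + lam *\<^sub>R T x)"
  unfolding Ph_def ph_ph_T by (simp add: ph_simps ph_xt algebra_simps)

lemma Ph_selfadj: "h (Ph x) y = h x (Ph y)"
  unfolding Ph_def by (simp add: lin_simps bil_simps ph_selfadj)

lemma Ph_Ph: "Ph (Ph x) = - x + et x *\<^sub>R xt"
proof -
  define p where "p = mu - lam"
  define U where "U x = p *\<^sub>R x + lam *\<^sub>R T x" for x
  have PhU: "Ph x = ph (U x)" for x unfolding Ph_eq U_def p_def ..
  have "U (ph x) = ph (U x)" for x unfolding U_def by (simp add: T_ph ph_simps)
  then have "Ph (Ph x) = ph (ph (U (U x)))" by (simp add: PhU)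
  also have "U (U x) = p\<^sup>2 *\<^sub>R x + (2 * p * lam + lam\<^sup>2 * (1 - k\<^sup>2)) *\<^sub>R T x"
    unfolding U_def
    by (simp add: T_simps T_T algebra_simps power2_eq_square flip: scaleR_add_left)
  also have "ph (ph \<dots>) = p\<^sup>2 *\<^sub>R ph (ph x) + (2 * p * lam + lam\<^sup>2 * (1 - k\<^sup>2)) *\<^sub>R ph (ph (T x))"
    by (simp add: ph_simps)
  also have "ph (ph (T x)) = - (k\<^sup>2) *\<^sub>R T x"
    unfolding ph_ph_T by (simp add: et_T T_T algebra_simps)
  also have "p\<^sup>2 *\<^sub>R ph (ph x) + (2 * p * lam + lam\<^sup>2 * (1 - k\<^sup>2)) *\<^sub>R (- (k\<^sup>2) *\<^sub>R T x)
     = p\<^sup>2 *\<^sub>R ph (ph x) - (k\<^sup>2 * lam * (2 * mu - lam - lam * k\<^sup>2)) *\<^sub>R T x"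
    by (simp add: p_def algebra_simps power2_eq_square)
  \<comment> \<open>The first condition normalises the square of \<open>ph\<close>, and the second
    makes the coefficient of \<open>T x\<close> equal to -1, cancelling the \<open>T\<close> term of
    \<open>ph_ph_T\<close>.\<close>
  also have "\<dots> = ph (ph x) - T x"
    using coeff1 coeff2 by (simp add: p_def)
  finally show ?thesis unfolding ph_ph_T by simp
qed

lemma h_Ph_Ph: "h (Ph x) (Ph y) = - h x y + et x * et y"
  unfolding Ph_selfadj Ph_Ph by (simp add: lin_simps bil_simps et_h)

end

end

section \<open>Charts\<close>

text \<open>The charts may belong to different manifolds on the same points. Thus one Jacobian
  covers changes of coordinates within a manifold, \<open>components\<close>,
  \<open>coord_vector\<close> and the differential of an inclusion.\<close>

definition chart_change ::
    "('a, 'e::euclidean_space) chart \<Rightarrow> ('a, 'f::euclidean_space) chart \<Rightarrow> 'a \<Rightarrow> 'e \<Rightarrow> 'f" where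
  "chart_change c d p = frechet_derivative (snd d \<circ> chart_inv c) (at (snd c p))"

lemma components_chart_change: "components M c p = chart_change (chart_at M p) c p"
  by (simp add: components_def chart_change_def)

lemma coord_vector_chart_change: "coord_vector M c p = chart_change c (chart_at M p) p"
  by (simp add: coord_vector_def chart_change_def)

lemma incl_chart_change: "incl M N p = chart_change (chart_at M p) (chart_at N p) p"
  by (simp add: incl_def differential_def chart_change_def o_def)

context
  fixes T :: "'a topology" and c :: "('a, 'e::euclidean_space) chart"
  assumes chart: "is_chart T c"
begin

lemma chart_subset_topspace: "fst c \<subseteq> topspace T"
  using chart by (simp add: is_chart_def openin_subset)

lemma chart_topspace_Int: "topspace T \<inter> fst c = fst c"
  using chart_subset_topspace by blast

lemma chart_inj_on: "inj_on (snd c) (fst c)"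
  using chart homeomorphic_imp_injective_map chart_topspace_Int unfolding is_chart_def
  by fastforce

lemma chart_inv_chart: "p \<in> fst c \<Longrightarrow> chart_inv c (snd c p) = p"
  using chart_inj_on by (simp add: chart_inv_def)

lemma open_chart_image:
  assumes "openin T U" "U \<subseteq> fst c"
  shows "open (snd c ` U)"
proof -
  have "openin (subtopology T (fst c)) U"
    using assms by (simp add: openin_subtopology_alt) blast
  then have "openin (top_of_set (snd c ` fst c)) (snd c ` U)"
    using chart homeomorphic_imp_open_map unfolding is_chart_def open_map_def by blast
  then show ?thesis
    using chart by (auto simp: is_chart_def intro: openin_open_trans)
qed

end

text \<open>The case of equal manifolds is included, so facts proved once for inclusions also apply
  to the transition maps of a single manifold.\<close>

definition smooth_inclusion ::
    "('a, 'e::euclidean_space) manifold \<Rightarrow> ('a, 'f::euclidean_space) manifold \<Rightarrow> bool" where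
  "smooth_inclusion M N \<longleftrightarrow> smooth_manifold M \<and> smooth_manifold N \<and> smooth_map M N (\<lambda>p. p)"

lemma smooth_inclusion_refl: "smooth_manifold M \<Longrightarrow> smooth_inclusion M M"
  unfolding smooth_inclusion_def smooth_map_def smooth_manifold_def
  by (simp add: o_def)

lemma smooth_manifold_chart: "smooth_manifold M \<Longrightarrow> c \<in> atlas M \<Longrightarrow> is_chart (mtop M) c"
  by (simp add: smooth_manifold_def)

lemma smooth_manifold_chart_subset: "smooth_manifold M \<Longrightarrow> c \<in> atlas M \<Longrightarrow> fst c \<subseteq> points M"
  by (rule chart_subset_topspace[OF smooth_manifold_chart])

lemma smooth_inclusion_points: "smooth_inclusion M N \<Longrightarrow> points M \<subseteq> points N"
  unfolding smooth_inclusion_def smooth_map_def continuous_map_def by auto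

lemma chart_at_atlas:
  assumes "smooth_manifold M" "p \<in> points M"
  shows "chart_at M p \<in> atlas M" "p \<in> fst (chart_at M p)"
proof -
  have "\<exists>c. c \<in> atlas M \<and> p \<in> fst c"
    using assms unfolding smooth_manifold_def by blast
  from someI_ex[OF this] show "chart_at M p \<in> atlas M" "p \<in> fst (chart_at M p)"
    by (simp_all add: chart_at_def)
qed

context
  fixes M :: "('a, 'e::euclidean_space) manifold" and N :: "('a, 'f::euclidean_space) manifold"
    and c :: "('a, 'e) chart" and d :: "('a, 'f) chart"
  assumes MN: "smooth_inclusion M N" and c: "c \<in> atlas M" and d: "d \<in> atlas N"
begin

lemma open_chart_overlap: "open (snd c ` (fst c \<inter> fst d))"
proof (rule open_chart_image[where T = "mtop M"])
  show c': "is_chart (mtop M) c"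
    using MN smooth_manifold_chart[OF _ c] unfolding smooth_inclusion_def by blast
  have "openin (mtop N) (fst d)"
    using MN smooth_manifold_chart[OF _ d] unfolding smooth_inclusion_def is_chart_def by blast
  \<comment> \<open>The topology of \<open>M\<close> may be finer than the subspace topology;
    continuity of the inclusion makes the domain of \<open>d\<close> open in it.\<close>
  then have "openin (mtop M) {p \<in> points M. p \<in> fst d}"
    using MN by (auto simp: smooth_inclusion_def smooth_map_def continuous_map_def)
  moreover have "openin (mtop M) (fst c)"
    using c' by (simp add: is_chart_def)
  ultimately have "openin (mtop M) (fst c \<inter> {p \<in> points M. p \<in> fst d})"
    by blast
  moreover have "fst c \<inter> {p \<in> points M. p \<in> fst d} = fst c \<inter> fst d"
    using chart_subset_topspace[OF c'] by blast
  ultimately show "openin (mtop M) (fst c \<inter> fst d)"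
    by simp
qed simp

lemma smooth_on_chart_overlap: "smooth_on (snd d \<circ> chart_inv c) (snd c ` (fst c \<inter> fst d))"
  using MN c d unfolding smooth_inclusion_def smooth_map_def
  by (auto simp: o_def vimage_def)

lemma chart_change_has_derivative:
  "p \<in> fst c \<Longrightarrow> p \<in> fst d \<Longrightarrow>
    ((snd d \<circ> chart_inv c) has_derivative chart_change c d p) (at (snd c p))"
  unfolding chart_change_def
  by (rule smooth_on_has_derivative[OF smooth_on_chart_overlap open_chart_overlap]) simp

lemma linear_chart_change: "p \<in> fst c \<Longrightarrow> p \<in> fst d \<Longrightarrow> linear (chart_change c d p)"
  using chart_change_has_derivative has_derivative_linear by blast

lemma chart_inv_overlap: "p \<in> fst c \<Longrightarrow> chart_inv c (snd c p) = p"
  using MN chart_inv_chart[OF smooth_manifold_chart[OF _ c]] unfolding smooth_inclusion_def by blast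

end

lemma chart_change_self:
  assumes M: "smooth_manifold M" and c: "c \<in> atlas M" and p: "p \<in> fst c"
  shows "chart_change c c p u = u"
proof -
  note MM = smooth_inclusion_refl[OF M]
  have "((\<lambda>x. x) has_derivative chart_change c c p) (at (snd c p))"
    by (rule has_derivative_transform_within_open[OF chart_change_has_derivative[OF MM c c p p]
          open_chart_overlap[OF MM c c]])
      (use p chart_inv_overlap[OF MM c c] in auto)
  then show ?thesis
    using has_derivative_unique[OF _ has_derivative_ident] by metis
qed

text \<open>The chain rule as a cocycle identity. Three manifolds allow an inclusion to be combined
  with coordinate changes on either side.\<close>

lemma chart_change_trans:
  assumes MN: "smooth_inclusion M N" and NP: "smooth_inclusion N P" and MP: "smooth_inclusion M P"
    and c: "c \<in> atlas M" "p \<in> fst c" and d: "d \<in> atlas N" "p \<in> fst d" and e: "e \<in> atlas P" "p \<in> fst e"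
  shows "chart_change d e p (chart_change c d p u) = chart_change c e p u"
proof -
  have cp: "(snd d \<circ> chart_inv c) (snd c p) = snd d p"
    using chart_inv_overlap[OF MN c(1) d(1) c(2)] by simp
  have "((snd e \<circ> chart_inv d) \<circ> (snd d \<circ> chart_inv c) has_derivative
      chart_change d e p \<circ> chart_change c d p) (at (snd c p))"
    using chart_change_has_derivative[OF MN c(1) d(1) c(2) d(2)]
      chart_change_has_derivative[OF NP d(1) e(1) d(2) e(2)]
    by (intro diff_chain_at) (simp_all only: cp)
  then have "((snd e \<circ> chart_inv c) has_derivative chart_change d e p \<circ> chart_change c d p)
      (at (snd c p))"
    by (rule has_derivative_transform_within_open[OF _ open_chart_overlap[OF MN c(1) d(1)]])
      (use c d chart_inv_overlap[OF MN c(1) d(1)] chart_inv_overlap[OF NP d(1) e(1)] in auto)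
  from has_derivative_unique[OF this chart_change_has_derivative[OF MP c(1) e(1) c(2) e(2)]]
  show ?thesis by (simp add: fun_eq_iff)
qed

context
  fixes M :: "('a, 'e::euclidean_space) manifold" and c :: "('a, 'e) chart" and p :: 'a
  assumes M: "smooth_manifold M" and c: "c \<in> atlas M" and p: "p \<in> fst c"
begin

lemma chart_at_of_chart: "chart_at M p \<in> atlas M" "p \<in> fst (chart_at M p)"
  using chart_at_atlas[OF M] smooth_manifold_chart_subset[OF M c] p by auto

lemma components_coord_vector: "components M c p (coord_vector M c p u) = u"
  unfolding components_chart_change coord_vector_chart_change
  using chart_change_trans[OF smooth_inclusion_refl smooth_inclusion_refl smooth_inclusion_refl,
      OF M M M c p chart_at_of_chart c p] chart_change_self[OF M c p] by simp

lemma coord_vector_components: "coord_vector M c p (components M c p v) = v"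
  unfolding components_chart_change coord_vector_chart_change
  using chart_change_trans[OF smooth_inclusion_refl smooth_inclusion_refl smooth_inclusion_refl,
      OF M M M chart_at_of_chart c p chart_at_of_chart] chart_change_self[OF M chart_at_of_chart]
  by simp

lemma linear_components: "linear (components M c p)"
  and linear_coord_vector: "linear (coord_vector M c p)"
  unfolding components_chart_change coord_vector_chart_change
  using linear_chart_change[OF smooth_inclusion_refl[OF M]] c p chart_at_of_chart by auto

end

lemma linear_incl:
  assumes "smooth_inclusion M N" "p \<in> points M"
  shows "linear (incl M N p)"
  unfolding incl_chart_change
  using assms smooth_inclusion_points[OF assms(1)] chart_at_atlas[of M p] chart_at_atlas[of N p]
  by (intro linear_chart_change[of M N]) (auto simp: smooth_inclusion_def)

text \<open>By the cocycle identity both sides are the Jacobian from \<open>chart_at M p\<close> to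
  \<open>d\<close> applied to \<open>v\<close>, so the arbitrary choices of \<open>chart_at\<close>
  disappear.\<close>

lemma components_incl:
  assumes MN: "smooth_inclusion M N" and c: "c \<in> atlas M" "p \<in> fst c" and d: "d \<in> atlas N" "p \<in> fst d"
  shows "components N d p (incl M N p v) = chart_change c d p (components M c p v)"
proof -
  have M: "smooth_manifold M" and N: "smooth_manifold N"
    using MN by (auto simp: smooth_inclusion_def)
  note MM = smooth_inclusion_refl[OF M] and NN = smooth_inclusion_refl[OF N]
  note a = chart_at_of_chart[OF M c] and b = chart_at_of_chart[OF N d]
  show ?thesis
    unfolding components_chart_change incl_chart_change
    using chart_change_trans[OF MN NN MN a b d] chart_change_trans[OF MM MN MN a c d] by simp
qed

text \<open>Fields along the submanifold \<open>M\<close> of \<open>N\<close>, restricted to the overlap of a chart \<open>c\<close> of \<open>M\<close> and a chart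
  \<open>d\<close> of \<open>N\<close> and read in the coordinates of \<open>c\<close>. Tangent vectors of \<open>M\<close> have components in \<open>c\<close>, those
  of \<open>N\<close> in \<open>d\<close>.\<close>

locale chart_overlap =
  fixes M :: "('a, 'f::euclidean_space) manifold" and N :: "('a, 'e::euclidean_space) manifold"
    and c :: "('a, 'f) chart" and d :: "('a, 'e) chart"
  assumes MN: "smooth_inclusion M N" and c: "c \<in> atlas M" and d: "d \<in> atlas N"
begin

abbreviation S where "S \<equiv> snd c ` (fst c \<inter> fst d)"

definition smooth_scalar :: "('a \<Rightarrow> real) \<Rightarrow> bool" where
  "smooth_scalar f \<longleftrightarrow> smooth_on (f \<circ> chart_inv c) S"

definition smooth_ambient :: "('a \<Rightarrow> 'e) \<Rightarrow> bool" where
  "smooth_ambient X \<longleftrightarrow> smooth_on ((\<lambda>p. components N d p (X p)) \<circ> chart_inv c) S"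

definition smooth_tangent :: "('a \<Rightarrow> 'f) \<Rightarrow> bool" where
  "smooth_tangent X \<longleftrightarrow> smooth_on ((\<lambda>p. components M c p (X p)) \<circ> chart_inv c) S"

lemma M: "smooth_manifold M" and N: "smooth_manifold N"
  using MN by (auto simp: smooth_inclusion_def)

lemma openS: "open S"
  by (rule open_chart_overlap[OF MN c d])

lemma chart_inv_S:
  assumes "x \<in> S"
  shows "chart_inv c x \<in> fst c" "chart_inv c x \<in> fst d" "snd c (chart_inv c x) = x"
    "chart_inv c x \<in> points M" "chart_inv c x \<in> points N"
  using assms chart_inv_overlap[OF MN c d] smooth_manifold_chart_subset[OF M c]
    smooth_manifold_chart_subset[OF N d] by auto

lemma smooth_on_S_cong:
  "(\<And>p. p \<in> fst c \<Longrightarrow> p \<in> fst d \<Longrightarrow> f p = g p) \<Longrightarrow>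
    smooth_on (f \<circ> chart_inv c) S \<longleftrightarrow> smooth_on (g \<circ> chart_inv c) S"
  by (rule smooth_on_cong[OF openS]) (simp add: chart_inv_S)

lemma smooth_scalar_cong:
  "(\<And>p. p \<in> fst c \<Longrightarrow> p \<in> fst d \<Longrightarrow> f p = g p) \<Longrightarrow> smooth_scalar f \<longleftrightarrow> smooth_scalar g"
  unfolding smooth_scalar_def by (rule smooth_on_S_cong)

lemma smooth_ambient_cong:
  "(\<And>p. p \<in> fst c \<Longrightarrow> p \<in> fst d \<Longrightarrow> X p = Y p) \<Longrightarrow> smooth_ambient X \<longleftrightarrow> smooth_ambient Y"
  unfolding smooth_ambient_def by (rule smooth_on_S_cong) simp

lemma smooth_tangent_cong:
  "(\<And>p. p \<in> fst c \<Longrightarrow> p \<in> fst d \<Longrightarrow> X p = Y p) \<Longrightarrow> smooth_tangent X \<longleftrightarrow> smooth_tangent Y"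
  unfolding smooth_tangent_def by (rule smooth_on_S_cong) simp

lemma smooth_on_pullback:
  fixes f :: "'a \<Rightarrow> 'v::real_normed_vector"
  assumes "smooth_on (f \<circ> chart_inv d) (snd d ` fst d)"
  shows "smooth_on (f \<circ> chart_inv c) S"
proof -
  have inv: "chart_inv d (snd d p) = p" if "p \<in> fst d" for p
    using chart_inv_chart[OF smooth_manifold_chart[OF N d] that] .
  have "smooth_on ((f \<circ> chart_inv d) \<circ> (snd d \<circ> chart_inv c)) S"
  proof (rule smooth_on_compose[OF openS _ _ smooth_on_chart_overlap[OF MN c d] assms])
    show "open (snd d ` fst d)"
      using smooth_manifold_chart[OF N d] by (simp add: is_chart_def)
    show "(snd d \<circ> chart_inv c) ` S \<subseteq> snd d ` fst d"
      using chart_inv_S(2) by auto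
  qed
  then show ?thesis
    by (rule smooth_on_cong[OF openS, THEN iffD1, rotated]) (simp add: inv chart_inv_S)
qed

section \<open>Algebra of smooth scalars and fields on an overlap\<close>

lemma smooth_scalar_const: "smooth_scalar (\<lambda>p. r)"
  unfolding smooth_scalar_def o_def by (rule smooth_on_const[OF openS])

lemma smooth_scalar_minus: "smooth_scalar f \<Longrightarrow> smooth_scalar (\<lambda>p. - f p)"
  unfolding smooth_scalar_def o_def
  by (rule smooth_on_bounded_linear[OF bounded_linear_minus[OF bounded_linear_ident] openS])

lemma smooth_scalar_add: "smooth_scalar f \<Longrightarrow> smooth_scalar g \<Longrightarrow> smooth_scalar (\<lambda>p. f p + g p)"
  unfolding smooth_scalar_def o_def by (rule smooth_on_add[OF openS])

lemma smooth_scalar_diff: "smooth_scalar f \<Longrightarrow> smooth_scalar g \<Longrightarrow> smooth_scalar (\<lambda>p. f p - g p)"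
  using smooth_scalar_add[OF _ smooth_scalar_minus, of f g] by simp

lemma smooth_scalar_mult: "smooth_scalar f \<Longrightarrow> smooth_scalar g \<Longrightarrow> smooth_scalar (\<lambda>p. f p * g p)"
  unfolding smooth_scalar_def o_def
  by (rule bounded_bilinear.smooth_on_prod[OF bounded_bilinear_mult openS])

lemma smooth_scalar_power: "smooth_scalar f \<Longrightarrow> smooth_scalar (\<lambda>p. f p ^ m)"
  by (induction m) (simp_all add: smooth_scalar_const smooth_scalar_mult)

lemma smooth_scalar_divide:
  assumes "smooth_scalar f" "smooth_scalar g" "\<And>p. p \<in> fst c \<Longrightarrow> p \<in> fst d \<Longrightarrow> g p \<noteq> 0"
  shows "smooth_scalar (\<lambda>p. f p / g p)"
  unfolding smooth_scalar_def
\<comment> \<open>The quotient solves a linear system with one unknown and coefficient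
  \<open>g\<close>.\<close>
proof (rule smooth_on_linear_solution[where A = "\<lambda>x u. g (chart_inv c x) * u" and w = "f \<circ> chart_inv c", OF openS])
  show "smooth_on (\<lambda>x. g (chart_inv c x) * b) S" for b
    using smooth_scalar_mult[OF assms(2) smooth_scalar_const] by (simp add: smooth_scalar_def o_def)
  show "smooth_on (f \<circ> chart_inv c) S"
    using assms(1) by (simp add: smooth_scalar_def)
qed (use assms(3) chart_inv_S in \<open>auto simp: linear_iff algebra_simps inj_on_def\<close>)

lemma smooth_ambient_add:
  "smooth_ambient X \<Longrightarrow> smooth_ambient Y \<Longrightarrow> smooth_ambient (\<lambda>p. X p + Y p)"
  unfolding smooth_ambient_def
  by (drule (1) smooth_on_add[OF openS], erule smooth_on_cong[OF openS, THEN iffD1, rotated])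
    (simp add: linear_add[OF linear_components[OF N d]] chart_inv_S)

lemma smooth_ambient_scaleR:
  "smooth_scalar f \<Longrightarrow> smooth_ambient X \<Longrightarrow> smooth_ambient (\<lambda>p. f p *\<^sub>R X p)"
  unfolding smooth_ambient_def smooth_scalar_def
  by (drule (1) bounded_bilinear.smooth_on_prod[OF bounded_bilinear_scaleR openS],
      erule smooth_on_cong[OF openS, THEN iffD1, rotated])
    (simp add: linear_scale[OF linear_components[OF N d]] chart_inv_S)

lemma smooth_ambient_minus: "smooth_ambient X \<Longrightarrow> smooth_ambient (\<lambda>p. - X p)"
  using smooth_ambient_scaleR[OF smooth_scalar_const, of X "- 1"] by simp

lemma smooth_ambient_diff:
  "smooth_ambient X \<Longrightarrow> smooth_ambient Y \<Longrightarrow> smooth_ambient (\<lambda>p. X p - Y p)"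
  using smooth_ambient_add[OF _ smooth_ambient_minus, of X Y] by simp

lemma smooth_tangent_add:
  "smooth_tangent X \<Longrightarrow> smooth_tangent Y \<Longrightarrow> smooth_tangent (\<lambda>p. X p + Y p)"
  unfolding smooth_tangent_def
  by (drule (1) smooth_on_add[OF openS], erule smooth_on_cong[OF openS, THEN iffD1, rotated])
    (simp add: linear_add[OF linear_components[OF M c]] chart_inv_S)

lemma smooth_tangent_scaleR:
  "smooth_scalar f \<Longrightarrow> smooth_tangent X \<Longrightarrow> smooth_tangent (\<lambda>p. f p *\<^sub>R X p)"
  unfolding smooth_tangent_def smooth_scalar_def
  by (drule (1) bounded_bilinear.smooth_on_prod[OF bounded_bilinear_scaleR openS],
      erule smooth_on_cong[OF openS, THEN iffD1, rotated])
    (simp add: linear_scale[OF linear_components[OF M c]] chart_inv_S)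

lemma smooth_tangent_coord_vector: "smooth_tangent (\<lambda>p. coord_vector M c p u)"
  unfolding smooth_tangent_def
  by (rule smooth_on_cong[OF openS, THEN iffD1, rotated, OF smooth_on_const[OF openS]])
    (simp add: components_coord_vector[OF M c] chart_inv_S)

section \<open>Smoothness inherited from global fields and tensors\<close>

lemma smooth_scalar_function: "smooth_function M f \<Longrightarrow> smooth_scalar f"
  unfolding smooth_function_def smooth_scalar_def smooth_on_def
  using c Ck_on_subset[of _ "f \<circ> chart_inv c" "snd c ` fst c" S] by blast

lemma smooth_ambient_vector_field: "vector_field N X \<Longrightarrow> smooth_ambient X"
  unfolding vector_field_def smooth_ambient_def using d smooth_on_pullback by blast

lemma smooth_ambient_along: "vector_field_along M N (\<lambda>p. p) X \<Longrightarrow> smooth_ambient X"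
  unfolding vector_field_along_def smooth_ambient_def using c d by (simp add: vimage_def)

lemma smooth_ambient_tensor_11:
  assumes A: "tensor_field_11 N A" and X: "smooth_ambient X"
  shows "smooth_ambient (\<lambda>p. A p (X p))"
proof -
  define L where "L p u = components N d p (A p (coord_vector N d p u))" for p u
  have "smooth_on (\<lambda>x. L (chart_inv c x) (((\<lambda>p. components N d p (X p)) \<circ> chart_inv c) x)) S"
  proof (rule smooth_on_linear_apply[where L = "\<lambda>x. L (chart_inv c x)", OF openS])
    show "linear (L (chart_inv c x))" if "x \<in> S" for x
      using A chart_inv_S[OF that] linear_components[OF N d] linear_coord_vector[OF N d]
      by (simp add: L_def linear_iff tensor_field_11_def)
    show "smooth_on (\<lambda>x. L (chart_inv c x) b) S" for b
      using smooth_on_pullback[of "\<lambda>p. L p b"] A d by (simp add: L_def tensor_field_11_def o_def)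
    show "smooth_on ((\<lambda>p. components N d p (X p)) \<circ> chart_inv c) S"
      using X by (simp add: smooth_ambient_def)
  qed
  then show ?thesis
    unfolding smooth_ambient_def
    by (rule smooth_on_cong[OF openS, THEN iffD1, rotated])
      (simp add: L_def coord_vector_components[OF N d] chart_inv_S)
qed

lemma smooth_scalar_tensor_02:
  assumes g: "tensor_field_02 N g" and X: "smooth_ambient X" and Y: "smooth_ambient Y"
  shows "smooth_scalar (\<lambda>p. g p (X p) (Y p))"
proof -
  define B where "B p u v = g p (coord_vector N d p u) (coord_vector N d p v)" for p u v
  have lin: "linear (B (chart_inv c x) u)" "linear (\<lambda>u. B (chart_inv c x) u v)" if "x \<in> S" for x u v
    using g chart_inv_S[OF that] linear_coord_vector[OF N d]
    by (simp_all add: B_def linear_iff tensor_field_02_def bilinear_def)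
  have sX: "smooth_on (\<lambda>x. components N d (chart_inv c x) (X (chart_inv c x))) S"
    and sY: "smooth_on (\<lambda>x. components N d (chart_inv c x) (Y (chart_inv c x))) S"
    using X Y by (simp_all add: smooth_ambient_def o_def)
  have sB: "smooth_on (\<lambda>x. B (chart_inv c x) u v) S" for u v
    using smooth_on_pullback[of "\<lambda>p. B p u v"] g d by (simp add: B_def tensor_field_02_def o_def)
  have "smooth_on (\<lambda>x. B (chart_inv c x) (components N d (chart_inv c x) (X (chart_inv c x))) v) S" for v
    by (rule smooth_on_linear_apply[where L = "\<lambda>x u. B (chart_inv c x) u v", OF openS lin(2) sB sX])
  then have "smooth_on (\<lambda>x. B (chart_inv c x) (components N d (chart_inv c x) (X (chart_inv c x)))
      (components N d (chart_inv c x) (Y (chart_inv c x)))) S"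
    by (intro smooth_on_linear_apply[where
          L = "\<lambda>x. B (chart_inv c x) (components N d (chart_inv c x) (X (chart_inv c x)))",
          OF openS lin(1) _ sY])
  then show ?thesis
    unfolding smooth_scalar_def
    by (rule smooth_on_cong[OF openS, THEN iffD1, rotated])
      (simp add: B_def coord_vector_components[OF N d] chart_inv_S)
qed

lemma smooth_on_chart_change: "smooth_on (\<lambda>x. chart_change c d (chart_inv c x) u) S"
  using smooth_on_frechet_derivative[OF smooth_on_chart_overlap[OF MN c d]]
  by (rule smooth_on_cong[OF openS, THEN iffD1, rotated]) (simp add: chart_change_def chart_inv_S)

lemma components_incl_S:
  "x \<in> S \<Longrightarrow> components N d (chart_inv c x) (incl M N (chart_inv c x) v) =
    chart_change c d (chart_inv c x) (components M c (chart_inv c x) v)"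
  using components_incl[OF MN c _ d] chart_inv_S by blast

lemma smooth_ambient_incl:
  assumes "smooth_tangent X"
  shows "smooth_ambient (\<lambda>p. incl M N p (X p))"
proof -
  have "smooth_on (\<lambda>x. chart_change c d (chart_inv c x)
      (((\<lambda>p. components M c p (X p)) \<circ> chart_inv c) x)) S"
    by (rule smooth_on_linear_apply[OF openS _ smooth_on_chart_change])
      (use assms linear_chart_change[OF MN c d] chart_inv_S in \<open>auto simp: smooth_tangent_def o_def\<close>)
  then show ?thesis
    unfolding smooth_ambient_def
    by (rule smooth_on_cong[OF openS, THEN iffD1, rotated]) (simp add: components_incl_S)
qed

text \<open>In coordinates \<open>X\<close> solves a linear system whose matrix is the Jacobian of
  the inclusion. It has full column rank for an immersion, so smoothness of the image passes back to
  \<open>X\<close>.\<close>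

lemma smooth_tangent_of_incl:
  assumes inj: "\<And>p. p \<in> points M \<Longrightarrow> inj (incl M N p)" and X: "smooth_ambient (\<lambda>p. incl M N p (X p))"
  shows "smooth_tangent X"
  unfolding smooth_tangent_def
proof (rule smooth_on_linear_solution[where A = "\<lambda>x. chart_change c d (chart_inv c x)",
      OF openS _ _ smooth_on_chart_change X[unfolded smooth_ambient_def]])
  show "linear (chart_change c d (chart_inv c x))" if "x \<in> S" for x
    using linear_chart_change[OF MN c d] chart_inv_S[OF that] by blast
  \<comment> \<open>\<open>components\<close> and \<open>coord_vector\<close> are mutually inverse,
    so injectivity of \<open>incl\<close> transfers from the chosen charts to \<open>c\<close> and
    \<open>d\<close>.\<close>
  show "inj (chart_change c d (chart_inv c x))" if "x \<in> S" for x
  proof (rule injI)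
    let ?p = "chart_inv c x"
    fix u v assume eq: "chart_change c d ?p u = chart_change c d ?p v"
    note p = chart_inv_S[OF that]
    have "components N d ?p (incl M N ?p (coord_vector M c ?p w)) = chart_change c d ?p w" for w
      using components_incl_S[OF that] components_coord_vector[OF M c p(1)] by simp
    then have "incl M N ?p (coord_vector M c ?p u) = incl M N ?p (coord_vector M c ?p v)"
      using eq coord_vector_components[OF N d p(2)] by metis
    then have "coord_vector M c ?p u = coord_vector M c ?p v"
      using inj[OF p(4)] by (simp add: inj_eq)
    then show "u = v"
      using components_coord_vector[OF M c p(1)] by metis
  qed
qed (simp add: components_incl_S)

end

text \<open>The charts of \<open>N\<close> cover the domain of \<open>c\<close>, and smoothness is
  local.\<close>

lemma smooth_on_chart_cover:
  assumes MN: "smooth_inclusion M N" and c: "c \<in> atlas M"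
    and f: "\<And>d. d \<in> atlas N \<Longrightarrow> smooth_on f (snd c ` (fst c \<inter> fst d))"
  shows "smooth_on f (snd c ` fst c)"
proof (rule smooth_on_local)
  fix x assume "x \<in> snd c ` fst c"
  then obtain p where p: "p \<in> fst c" "x = snd c p" by blast
  have M: "smooth_manifold M" and N: "smooth_manifold N"
    using MN by (auto simp: smooth_inclusion_def)
  have "p \<in> points N"
    using p smooth_manifold_chart_subset[OF M c] smooth_inclusion_points[OF MN] by blast
  note d = chart_at_atlas[OF N this]
  show "\<exists>T. open T \<and> x \<in> T \<and> smooth_on f T"
    using open_chart_overlap[OF MN c d(1)] f[OF d(1)] p d(2) by blast
qed

section \<open>The induced structure\<close>

text \<open>The difference \<open>mu1 \<epsilon> k - lambda1 \<epsilon> k\<close> is just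
  \<open>\<epsilon>\<close>, and the bracket in the second condition reduces to
  \<open>\<epsilon> * (k + 1) / k\<close>.\<close>

lemma lambda1_mu1_coefficients:
  assumes "k \<noteq> 0" "k + 1 \<noteq> 0" "\<epsilon> \<in> {1, - 1}"
  shows "(mu1 \<epsilon> k - lambda1 \<epsilon> k)\<^sup>2 = 1"
    and "k\<^sup>2 * lambda1 \<epsilon> k * (2 * mu1 \<epsilon> k - lambda1 \<epsilon> k - lambda1 \<epsilon> k * k\<^sup>2) = 1"
proof -
  have e: "\<epsilon> * \<epsilon> = 1" using assms(3) by auto
  have "mu1 \<epsilon> k - lambda1 \<epsilon> k = (\<epsilon> * (1 + k\<^sup>2 + k) - \<epsilon>) / (k * (k + 1))"
    by (simp add: mu1_def lambda1_def diff_divide_distrib)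
  also have "\<epsilon> * (1 + k\<^sup>2 + k) - \<epsilon> = \<epsilon> * (k * (k + 1))"
    by (simp add: algebra_simps power2_eq_square)
  finally have "mu1 \<epsilon> k - lambda1 \<epsilon> k = \<epsilon>" using assms by simp
  then show "(mu1 \<epsilon> k - lambda1 \<epsilon> k)\<^sup>2 = 1" using e by (simp add: power2_eq_square)
  have "2 * mu1 \<epsilon> k - lambda1 \<epsilon> k - lambda1 \<epsilon> k * k\<^sup>2 =
      (2 * (\<epsilon> * (1 + k\<^sup>2 + k)) - \<epsilon> - \<epsilon> * k\<^sup>2) / (k * (k + 1))"
    by (simp add: mu1_def lambda1_def diff_divide_distrib)
  also have "2 * (\<epsilon> * (1 + k\<^sup>2 + k)) - \<epsilon> - \<epsilon> * k\<^sup>2 = \<epsilon> * ((k + 1) * (k + 1))"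
    by (simp add: algebra_simps power2_eq_square)
  also have "\<epsilon> * ((k + 1) * (k + 1)) / (k * (k + 1)) = \<epsilon> * (k + 1) / k"
    using assms by simp
  finally have "k\<^sup>2 * lambda1 \<epsilon> k * (2 * mu1 \<epsilon> k - lambda1 \<epsilon> k - lambda1 \<epsilon> k * k\<^sup>2) =
      k\<^sup>2 * (\<epsilon> / (k * (k + 1))) * (\<epsilon> * (k + 1) / k)"
    by (simp add: lambda1_def)
  also have "\<dots> = \<epsilon> * \<epsilon>"
    using assms by (simp add: power2_eq_square)
  finally show "k\<^sup>2 * lambda1 \<epsilon> k * (2 * mu1 \<epsilon> k - lambda1 \<epsilon> k - lambda1 \<epsilon> k * k\<^sup>2) = 1"
    using e by simp
qed

text \<open>Both coefficient conditions contain \<open>k\<close> only through its square, so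
  replacing \<open>k\<close> by \<open>- k\<close> transfers them to the second pair.\<close>

lemma lambda2_mu2_eq: "lambda2 \<epsilon> k = lambda1 \<epsilon> (- k)" "mu2 \<epsilon> k = mu1 \<epsilon> (- k)"
  by (simp_all add: lambda1_def lambda2_def mu1_def mu2_def algebra_simps)

lemma lambda2_mu2_coefficients:
  assumes "k \<noteq> 0" "k - 1 \<noteq> 0" "\<epsilon> \<in> {1, - 1}"
  shows "(mu2 \<epsilon> k - lambda2 \<epsilon> k)\<^sup>2 = 1"
    and "k\<^sup>2 * lambda2 \<epsilon> k * (2 * mu2 \<epsilon> k - lambda2 \<epsilon> k - lambda2 \<epsilon> k * k\<^sup>2) = 1"
  using lambda1_mu1_coefficients[of "- k" \<epsilon>] assms by (simp_all add: lambda2_mu2_eq)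

theorem mainTheorem1:
  fixes N :: "('a, 'e::euclidean_space) manifold"
    and M :: "('a, 'f::euclidean_space) manifold"
    and \<phi>N :: "'a \<Rightarrow> 'e \<Rightarrow> 'e" and \<xi>N :: "'a \<Rightarrow> 'e" and \<eta>N :: "'a \<Rightarrow> 'e \<Rightarrow> real"
    and g :: "'a \<Rightarrow> 'e \<Rightarrow> 'e \<Rightarrow> real"
    and N1 N2 :: "'a \<Rightarrow> 'e"
    and \<xi>0 \<xi>1 \<xi>2 \<xi> :: "'a \<Rightarrow> 'f"
    and \<eta>1 \<eta>2 \<eta> :: "'a \<Rightarrow> 'f \<Rightarrow> real"
    and \<phi> \<Phi> :: "'a \<Rightarrow> 'f \<Rightarrow> 'f"
    and a b k lam mu :: "'a \<Rightarrow> real"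
    and \<epsilon> :: real and n :: nat
  assumes ambient: "almost_contact_norden_manifold N \<phi>N \<xi>N \<eta>N g" "mdim N = 2 * n + 3"
    and submfd: "submanifold M N" "mdim N = mdim M + 2"
    and normal_fields: "vector_field_along M N (\<lambda>p. p) N1" "vector_field_along M N (\<lambda>p. p) N2"
      "\<And>p. p \<in> points M \<Longrightarrow> span {N1 p, N2 p} = normal_space_at M N g p"
    and i: "\<And>p. p \<in> points M \<Longrightarrow> g p (N1 p) (N1 p) = 1 \<and> g p (N2 p) (N2 p) = - 1 \<and> g p (N1 p) (N2 p) = 0"
    and ii: "\<And>p V W. p \<in> points M \<Longrightarrow> V \<in> {N1 p, N2 p} \<Longrightarrow> W \<in> {N1 p, N2 p} \<Longrightarrow> g p V (\<phi>N p W) = 0"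
    and iii: "\<And>p. p \<in> points M \<Longrightarrow> \<xi>N p \<notin> tangent_space M N p \<and> \<xi>N p \<notin> normal_space_at M N g p"
    and decomp_\<xi>: "\<And>p. p \<in> points M \<Longrightarrow> \<xi>N p = incl M N p (\<xi>0 p) + a p *\<^sub>R N1 p + b p *\<^sub>R N2 p"
    and decomp_\<phi>: "\<And>p X. p \<in> points M \<Longrightarrow>
      \<phi>N p (incl M N p X) = incl M N p (\<phi> p X) + \<eta>1 p X *\<^sub>R N1 p + \<eta>2 p X *\<^sub>R N2 p"
    and \<xi>1: "\<And>p. p \<in> points M \<Longrightarrow> \<phi>N p (N1 p) = incl M N p (\<xi>1 p)"
    and \<xi>2: "\<And>p. p \<in> points M \<Longrightarrow> \<phi>N p (N2 p) = - incl M N p (\<xi>2 p)"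
    and ab: "\<And>p. p \<in> points M \<Longrightarrow> a p \<noteq> 0 \<and> \<bar>a p\<bar> > \<bar>b p\<bar>"
    and k: "smooth_function M k" "\<And>p. p \<in> points M \<Longrightarrow> (a p)\<^sup>2 - (b p)\<^sup>2 = (k p)\<^sup>2"
    and \<epsilon>: "\<epsilon> \<in> {1, - 1}"
    and cases:
      "(\<forall>p\<in>points M. k p \<noteq> 1 \<and> k p \<noteq> - 1) \<and>
         ((\<forall>p\<in>points M. lam p = lambda1 \<epsilon> (k p) \<and> mu p = mu1 \<epsilon> (k p)) \<or>
          (\<forall>p\<in>points M. lam p = lambda2 \<epsilon> (k p) \<and> mu p = mu2 \<epsilon> (k p))) \<or>
       (\<forall>p\<in>points M. k p = - 1 \<and> lam p = lambda2 \<epsilon> (k p) \<and> mu p = mu2 \<epsilon> (k p)) \<or>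
       (\<forall>p\<in>points M. k p = 1 \<and> lam p = lambda1 \<epsilon> (k p) \<and> mu p = mu1 \<epsilon> (k p))"
    and \<xi>: "\<And>p. p \<in> points M \<Longrightarrow> \<xi> p = - (b p / k p) *\<^sub>R \<xi>1 p + (a p / k p) *\<^sub>R \<xi>2 p"
    and \<eta>: "\<And>p X. p \<in> points M \<Longrightarrow> \<eta> p X = - (b p / k p) * \<eta>1 p X + (a p / k p) * \<eta>2 p X"
    and \<Phi>: "\<And>p X. p \<in> points M \<Longrightarrow> \<Phi> p X = lam p *\<^sub>R (\<phi> p ^^ 3) X + mu p *\<^sub>R \<phi> p X"
  shows "mdim M = 2 * n + 1 \<and>
    almost_contact_norden_manifold M \<Phi> \<xi> \<eta> (restrict_metric M N g)"
proof -
  have M: "smooth_manifold M" and N: "smooth_manifold N" and MN: "smooth_inclusion M N"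
    and pts: "points M \<subseteq> points N" and inj: "\<And>p. p \<in> points M \<Longrightarrow> inj (incl M N p)"
    using submfd(1) ambient(1)
    by (auto simp: submanifold_def smooth_inclusion_def almost_contact_norden_manifold_def)
  have acs: "almost_contact_structure N \<phi>N \<xi>N \<eta>N" and nm: "norden_metric N \<phi>N \<eta>N g"
    using ambient(1) by (simp_all add: almost_contact_norden_manifold_def)
  have \<phi>N: "tensor_field_11 N \<phi>N" and \<xi>N: "vector_field N \<xi>N"
    using acs by (simp_all add: almost_contact_structure_def)
  have prm: "pseudo_riemannian_metric N g"
    using nm by (simp add: norden_metric_def)
  then have g: "tensor_field_02 N g" and g_sym: "\<And>p u v. p \<in> points N \<Longrightarrow> g p u v = g p v u"
    by (simp_all add: pseudo_riemannian_metric_def)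
  have dimM: "mdim M = 2 * n + 1"
    using ambient(2) submfd(2) by simp

  have pointwise: "norden_codim2 (\<phi>N p) (\<xi>N p) (\<eta>N p) (g p) (incl M N p) (N1 p) (N2 p)
      (\<xi>0 p) (\<xi>1 p) (\<xi>2 p) (\<phi> p) (\<eta>1 p) (\<eta>2 p) (a p) (b p) (k p)" if p: "p \<in> points M" for p
  proof (rule norden_codim2.intro)
    have pN: "p \<in> points N" using p pts by blast
    show "linear (\<phi>N p)" using \<phi>N pN by (simp add: tensor_field_11_def)
    show "bilinear (g p)" using g pN by (simp add: tensor_field_02_def)
    show "g p u v = g p v u" for u v by (rule g_sym[OF pN])
    show "\<phi>N p (\<phi>N p X) = - X + \<eta>N p X *\<^sub>R \<xi>N p" for X
      using acs pN by (simp add: almost_contact_structure_def)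
    show "\<eta>N p (\<xi>N p) = 1" using acs pN by (simp add: almost_contact_structure_def)
    show "g p (\<phi>N p X) (\<phi>N p Y) = - g p X Y + \<eta>N p X * \<eta>N p Y" for X Y
      using nm pN by (simp add: norden_metric_def)
    show "linear (incl M N p)" by (rule linear_incl[OF MN p])
    show "inj (incl M N p)" by (rule inj[OF p])
    have "N1 p \<in> normal_space_at M N g p" "N2 p \<in> normal_space_at M N g p"
      unfolding normal_fields(3)[OF p, symmetric] by (simp_all add: span_base)
    then show "g p (N1 p) (incl M N p x) = 0" "g p (N2 p) (incl M N p x) = 0" for x
      by (simp_all add: normal_space_at_def tangent_space_def)
    show "g p (N1 p) (N1 p) = 1" "g p (N2 p) (N2 p) = - 1" "g p (N1 p) (N2 p) = 0"
      using i[OF p] by simp_all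
    \<comment> \<open>The strict inequality between \<open>a\<close> and \<open>b\<close> makes
      \<open>k^2\<close> positive, so division by \<open>k\<close> is legitimate.\<close>
    have "\<bar>b p\<bar>\<^sup>2 < \<bar>a p\<bar>\<^sup>2" using ab[OF p] by (intro power_strict_mono) auto
    then show "k p \<noteq> 0" using k(2)[OF p] by auto
  qed (use decomp_\<xi> decomp_\<phi> \<xi>1 \<xi>2 k(2) p in auto)

  \<comment> \<open>The image of a vector in the radical is both tangent and normal, so uniqueness
    of the decomposition makes it zero.\<close>
  have nondeg: "u = 0" if p: "p \<in> points M" and u: "\<And>v. g p (incl M N p u) (incl M N p v) = 0" for p u
  proof -
    interpret norden_codim2 "\<phi>N p" "\<xi>N p" "\<eta>N p" "g p" "incl M N p" "N1 p" "N2 p" "\<xi>0 p" "\<xi>1 p"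
      "\<xi>2 p" "\<phi> p" "\<eta>1 p" "\<eta>2 p" "a p" "b p" "k p"
      by (rule pointwise[OF p])
    have "incl M N p u \<in> span {N1 p, N2 p}"
      using u normal_fields(3)[OF p] by (auto simp: normal_space_at_def tangent_space_def)
    then obtain r s where rs: "incl M N p u = r *\<^sub>R N1 p + s *\<^sub>R N2 p"
      by (auto simp: span_insert algebra_simps)
    then have "incl M N p u + 0 *\<^sub>R N1 p + 0 *\<^sub>R N2 p = incl M N p 0 + r *\<^sub>R N1 p + s *\<^sub>R N2 p"
      by (simp add: linear_0[OF lin_J])
    then show "u = 0" by (rule components_unique(1))
  qed

  \<comment> \<open>All alternatives reduce to one of the two coefficient pairs with its own
    denominator factor \<open>k + 1\<close> or \<open>k - 1\<close> nonzero.\<close>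
  have cases': "(\<forall>p\<in>points M. k p + 1 \<noteq> 0 \<and> lam p = lambda1 \<epsilon> (k p) \<and> mu p = mu1 \<epsilon> (k p)) \<or>
      (\<forall>p\<in>points M. k p - 1 \<noteq> 0 \<and> lam p = lambda2 \<epsilon> (k p) \<and> mu p = mu2 \<epsilon> (k p))"
    using cases by (auto simp: add_eq_0_iff2)

  have induced: "linear (\<Phi> p) \<and> linear (\<eta> p) \<and> bilinear (restrict_metric M N g p) \<and>
      \<Phi> p (\<Phi> p X) = - X + \<eta> p X *\<^sub>R \<xi> p \<and> \<eta> p (\<xi> p) = 1 \<and>
      restrict_metric M N g p (\<Phi> p X) (\<Phi> p Y) = - restrict_metric M N g p X Y + \<eta> p X * \<eta> p Y"
    if p: "p \<in> points M" for p X Y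
  proof -
    interpret norden_codim2 "\<phi>N p" "\<xi>N p" "\<eta>N p" "g p" "incl M N p" "N1 p" "N2 p" "\<xi>0 p" "\<xi>1 p"
      "\<xi>2 p" "\<phi> p" "\<eta>1 p" "\<eta>2 p" "a p" "b p" "k p"
      by (rule pointwise[OF p])
    have coeff: "(mu p - lam p)\<^sup>2 = 1" "(k p)\<^sup>2 * lam p * (2 * mu p - lam p - lam p * (k p)\<^sup>2) = 1"
      using cases' p lambda1_mu1_coefficients[OF k0 _ \<epsilon>] lambda2_mu2_coefficients[OF k0 _ \<epsilon>] by auto
    have "\<Phi> p = Ph (lam p) (mu p)"
      using \<Phi>[OF p] by (simp add: fun_eq_iff Ph_def[OF coeff] eval_nat_numeral)
    moreover have "\<xi> p = xt" "\<eta> p = et"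
      using \<xi>[OF p] \<eta>[OF p] by (simp_all add: fun_eq_iff xt_def et_def)
    moreover have "bilinear (restrict_metric M N g p)"
      by (auto simp: restrict_metric_def bilinear_def linear_iff lin_simps bil_simps)
    ultimately show ?thesis
      using linear_Ph[OF coeff] linear_et Ph_Ph[OF coeff] et_xt h_Ph_Ph[OF coeff]
      by (simp add: restrict_metric_def)
  qed

  \<comment> \<open>The ambient fields have coordinates only in charts of \<open>N\<close>, so
    smoothness is first shown on overlaps.\<close>
  have smooth: "smooth_on ((\<lambda>p. components M c p (\<xi> p)) \<circ> chart_inv c) (snd c ` (fst c \<inter> fst d)) \<and>
      smooth_on ((\<lambda>p. \<eta> p (coord_vector M c p u)) \<circ> chart_inv c) (snd c ` (fst c \<inter> fst d)) \<and>
      smooth_on ((\<lambda>p. components M c p (\<Phi> p (coord_vector M c p u))) \<circ> chart_inv c)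
        (snd c ` (fst c \<inter> fst d)) \<and>
      smooth_on ((\<lambda>p. restrict_metric M N g p (coord_vector M c p u) (coord_vector M c p v)) \<circ> chart_inv c)
        (snd c ` (fst c \<inter> fst d))"
    if c: "c \<in> atlas M" and d: "d \<in> atlas N" for c d u v
  proof -
    interpret chart_overlap M N c d
      using MN c d by unfold_locales
    have pM: "p \<in> points M" if "p \<in> fst c" for p
      using smooth_manifold_chart_subset[OF M c] that by blast
    have sN1: "smooth_ambient N1" and sN2: "smooth_ambient N2"
      using normal_fields(1,2) by (simp_all add: smooth_ambient_along)
    have s\<phi>N: "smooth_ambient (\<lambda>p. \<phi>N p (X p))" if "smooth_ambient X" for X
      by (rule smooth_ambient_tensor_11[OF \<phi>N that])
    have sg: "smooth_scalar (\<lambda>p. g p (X p) (Y p))" if "smooth_ambient X" "smooth_ambient Y" for X Y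
      by (rule smooth_scalar_tensor_02[OF g that])
    have sa: "smooth_scalar a"
      using sg[OF smooth_ambient_vector_field[OF \<xi>N] sN1]
      by (rule smooth_scalar_cong[THEN iffD1, rotated])
        (rule norden_codim2.a_eq[OF pointwise, OF pM, symmetric])
    have sb: "smooth_scalar b"
      using smooth_scalar_minus[OF sg[OF smooth_ambient_vector_field[OF \<xi>N] sN2]]
      by (rule smooth_scalar_cong[THEN iffD1, rotated])
        (rule norden_codim2.b_eq[OF pointwise, OF pM, symmetric])
    have s\<eta>1: "smooth_scalar (\<lambda>p. \<eta>1 p (X p))" if "smooth_tangent X" for X
      using sg[OF s\<phi>N[OF smooth_ambient_incl[OF that]] sN1]
      by (rule smooth_scalar_cong[THEN iffD1, rotated])
        (rule norden_codim2.e1_eq[OF pointwise, OF pM, symmetric])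
    have s\<eta>2: "smooth_scalar (\<lambda>p. \<eta>2 p (X p))" if "smooth_tangent X" for X
      using smooth_scalar_minus[OF sg[OF s\<phi>N[OF smooth_ambient_incl[OF that]] sN2]]
      by (rule smooth_scalar_cong[THEN iffD1, rotated])
        (rule norden_codim2.e2_eq[OF pointwise, OF pM, symmetric])
    have s\<phi>: "smooth_tangent (\<lambda>p. \<phi> p (X p))" if X: "smooth_tangent X" for X
    proof (rule smooth_tangent_of_incl[OF inj])
      \<comment> \<open>Removing the normal parts leaves the image of the tangential part, whose
        smoothness then passes back through the immersion.\<close>
      have "smooth_ambient (\<lambda>p. \<phi>N p (incl M N p (X p)) - \<eta>1 p (X p) *\<^sub>R N1 p - \<eta>2 p (X p) *\<^sub>R N2 p)"
        by (intro smooth_ambient_diff smooth_ambient_scaleR s\<phi>N smooth_ambient_incl X s\<eta>1 s\<eta>2 sN1 sN2)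
      then show "smooth_ambient (\<lambda>p. incl M N p (\<phi> p (X p)))"
        by (rule smooth_ambient_cong[THEN iffD1, rotated]) (simp add: decomp_\<phi> pM)
    qed
    have s\<xi>1: "smooth_tangent \<xi>1"
      using s\<phi>N[OF sN1] by (intro smooth_tangent_of_incl[OF inj])
        (auto intro: smooth_ambient_cong[THEN iffD1, rotated] simp: \<xi>1 pM)
    have s\<xi>2: "smooth_tangent \<xi>2"
      using smooth_ambient_minus[OF s\<phi>N[OF sN2]] by (intro smooth_tangent_of_incl[OF inj])
        (auto intro: smooth_ambient_cong[THEN iffD1, rotated] simp: \<xi>2 pM)
    have sk: "smooth_scalar k" by (rule smooth_scalar_function[OF k(1)])
    have k0: "k p \<noteq> 0" if "p \<in> fst c" for p
      using norden_codim2.k0[OF pointwise[OF pM[OF that]]] .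
    have slm: "smooth_scalar lam \<and> smooth_scalar mu"
      using cases'
    proof
      assume *: "\<forall>p\<in>points M. k p + 1 \<noteq> 0 \<and> lam p = lambda1 \<epsilon> (k p) \<and> mu p = mu1 \<epsilon> (k p)"
      have "smooth_scalar (\<lambda>p. lambda1 \<epsilon> (k p))" "smooth_scalar (\<lambda>p. mu1 \<epsilon> (k p))"
        unfolding lambda1_def mu1_def using * k0 pM
        by (intro smooth_scalar_divide smooth_scalar_mult smooth_scalar_add smooth_scalar_power
            smooth_scalar_const sk; simp)+
      then show ?thesis
        using * pM smooth_scalar_cong[of lam "\<lambda>p. lambda1 \<epsilon> (k p)"]
          smooth_scalar_cong[of mu "\<lambda>p. mu1 \<epsilon> (k p)"] by simp
    next
      assume *: "\<forall>p\<in>points M. k p - 1 \<noteq> 0 \<and> lam p = lambda2 \<epsilon> (k p) \<and> mu p = mu2 \<epsilon> (k p)"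
      have "smooth_scalar (\<lambda>p. lambda2 \<epsilon> (k p))" "smooth_scalar (\<lambda>p. mu2 \<epsilon> (k p))"
        unfolding lambda2_def mu2_def using * k0 pM
        by (intro smooth_scalar_divide smooth_scalar_mult smooth_scalar_add smooth_scalar_diff
            smooth_scalar_power smooth_scalar_const sk; simp)+
      then show ?thesis
        using * pM smooth_scalar_cong[of lam "\<lambda>p. lambda2 \<epsilon> (k p)"]
          smooth_scalar_cong[of mu "\<lambda>p. mu2 \<epsilon> (k p)"] by simp
    qed
    have sbk: "smooth_scalar (\<lambda>p. - (b p / k p))" and sak: "smooth_scalar (\<lambda>p. a p / k p)"
      using sa sb sk k0 by (auto intro!: smooth_scalar_minus smooth_scalar_divide)
    have "smooth_tangent (\<lambda>p. - (b p / k p) *\<^sub>R \<xi>1 p + (a p / k p) *\<^sub>R \<xi>2 p)"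
      by (intro smooth_tangent_add smooth_tangent_scaleR sbk sak s\<xi>1 s\<xi>2)
    then have s\<xi>: "smooth_tangent \<xi>"
      by (rule smooth_tangent_cong[THEN iffD1, rotated]) (simp add: \<xi> pM)
    let ?U = "\<lambda>p. coord_vector M c p u" and ?V = "\<lambda>p. coord_vector M c p v"
    note sU = smooth_tangent_coord_vector[of u] and sV = smooth_tangent_coord_vector[of v]
    have "smooth_scalar (\<lambda>p. - (b p / k p) * \<eta>1 p (?U p) + (a p / k p) * \<eta>2 p (?U p))"
      by (intro smooth_scalar_add smooth_scalar_mult sbk sak s\<eta>1 s\<eta>2 sU)
    then have s\<eta>: "smooth_scalar (\<lambda>p. \<eta> p (?U p))"
      by (rule smooth_scalar_cong[THEN iffD1, rotated]) (simp add: \<eta> pM)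
    have "smooth_tangent (\<lambda>p. lam p *\<^sub>R \<phi> p (\<phi> p (\<phi> p (?U p))) + mu p *\<^sub>R \<phi> p (?U p))"
      by (intro smooth_tangent_add smooth_tangent_scaleR s\<phi> sU slm[THEN conjunct1] slm[THEN conjunct2])
    then have s\<Phi>: "smooth_tangent (\<lambda>p. \<Phi> p (?U p))"
      by (rule smooth_tangent_cong[THEN iffD1, rotated]) (simp add: \<Phi> pM eval_nat_numeral)
    have "smooth_scalar (\<lambda>p. restrict_metric M N g p (?U p) (?V p))"
      unfolding restrict_metric_def by (intro sg smooth_ambient_incl sU sV)
    then show ?thesis
      using s\<xi> s\<eta> s\<Phi> by (simp add: smooth_scalar_def smooth_tangent_def)
  qed

  \<comment> \<open>The overlaps with charts of \<open>N\<close> are glued to whole charts of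
    \<open>M\<close>.\<close>
  have "vector_field M \<xi>" "one_form M \<eta>" "tensor_field_11 M \<Phi>"
    and tensor_h: "tensor_field_02 M (restrict_metric M N g)"
    using smooth induced
    by (auto simp: vector_field_def one_form_def tensor_field_11_def tensor_field_02_def
        intro!: smooth_on_chart_cover[OF MN])
  then have "almost_contact_structure M \<Phi> \<xi> \<eta>"
    using induced by (simp add: almost_contact_structure_def)
  moreover have "pseudo_riemannian_metric M (restrict_metric M N g)"
    unfolding pseudo_riemannian_metric_def
  proof (intro conjI ballI allI impI)
    \<comment> \<open>One pair \<open>(r, s)\<close> serves all points of \<open>N\<close>, so
      \<open>(r - 1, s - 1)\<close> serves all points of \<open>M\<close>.\<close>
    obtain r s where rs: "\<And>p. p \<in> points N \<Longrightarrow> has_signature (g p) r s"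
      using prm unfolding pseudo_riemannian_metric_def by blast
    have "has_signature (restrict_metric M N g p) (r - 1) (s - 1)" if p: "p \<in> points M" for p
    proof -
      interpret norden_codim2 "\<phi>N p" "\<xi>N p" "\<eta>N p" "g p" "incl M N p" "N1 p" "N2 p" "\<xi>0 p" "\<xi>1 p"
        "\<xi>2 p" "\<phi> p" "\<eta>1 p" "\<eta>2 p" "a p" "b p" "k p"
        by (rule pointwise[OF p])
      have "has_signature (\<lambda>u v. g p (incl M N p u) (incl M N p v)) (r - 1) (s - 1)"
        by (rule has_signature_codim2[OF bil sym _ lin_J inj_J orth1 orth2 _ _ nondeg[OF p]])
          (use rs p pts n11 n22 submfd(2) in \<open>auto simp: mdim_def\<close>)
      then show ?thesis
        by (simp add: restrict_metric_def[abs_def])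
    qed
    then show "\<exists>r s. \<forall>p\<in>points M. has_signature (restrict_metric M N g p) r s"
      by blast
  qed (use tensor_h g_sym pts nondeg in \<open>auto simp: restrict_metric_def\<close>)
  then have "norden_metric M \<Phi> \<eta> (restrict_metric M N g)"
    using induced by (simp add: norden_metric_def)
  ultimately show ?thesis
    using M dimM by (auto simp: almost_contact_norden_manifold_def)
qed

end
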